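(* Let $n,k\in\mathbb{N}=\{1,2,3,\dots\}$ with $n\ge 2$. Let $\gamma_n\in(1,2)$ be the multinacci number of order $n$, i.e. the unique positive real solution of $1=x^{-1}+x^{-2}+\dots+x^{-n}$. Let $\beta_{n,k}>1$ be defined by $(\beta_{n,k})^{2^k}=\gamma_n$ and set $\alpha_{n,k}=1-\beta_{n,k}/2$. Then: (1) the intermediate $\beta_{n,k}$-transformations $T^{+}_{\beta_{n,k},\alpha_{n,k}}$ and $T^{-}_{\beta_{n,k},\alpha_{n,k}}$ are not transitive; (2) the intermediate $\beta_{n,k}$-shift $\Omega_{\beta_{n,k},\alpha_{n,k}}$ is a subshift of finite type; (3) the greedy $\beta_{n,k}$-transformation $G_{\beta_{n,k}}=T^{+}_{\beta_{n,k},0}$ and the lazy $\beta_{n,k}$-transformation $L_{\beta_{n,k}}=T^{-}_{\beta_{n,k},2-\beta_{n,k}}$ are transitive; (4) the greedy $\beta_{n,k}$-shift $\Omega_{\beta_{n,k},0}$ and the lazy $\beta_{n,k}$-shift $\Omega_{\beta_{n,k},2-\beta_{n,k}}$ are not sofic, and hence not subshifts of finite type.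
   Context: Let $\Delta=\{(\beta,\alpha)\in\mathbb{R}^2:\beta\in(1,2),\ 0\le\alpha\le 2-\beta\}$. For $(\beta,\alpha)\in\Delta$ put $p=p_{\beta,\alpha}=(1-\alpha)/\beta$. The maps $T^{\pm}_{\beta,\alpha}:[0,1]\to[0,1]$ ($x\mapsto\beta x+\alpha \bmod 1$) are: $T^{+}_{\beta,\alpha}(x)=\beta x+\alpha$ if $x<p$ and $\beta x+\alpha-1$ if $x\ge p$; $T^{-}_{\beta,\alpha}(x)=\beta x+\alpha$ if $x\le p$ and $\beta x+\alpha-1$ if $x>p$. The expansion $\tau^{+}_{\beta,\alpha}(x)=(\omega_1,\omega_2,\dots)\in\{0,1\}^{\mathbb{N}}$ has $\omega_n=0$ if $(T^{+}_{\beta,\alpha})^{n-1}(x)<p$ and $\omega_n=1$ otherwise; $\tau^{-}_{\beta,\alpha}(x)$ has $\omega_n=0$ if $(T^{-}_{\beta,\alpha})^{n-1}(x)\le p$ and $\omega_n=1$ otherwise. Set $\Omega^{+}_{\beta,\alpha}=\tau^{+}_{\beta,\alpha}([0,1))$, $\Omega^{-}_{\beta,\alpha}=\tau^{-}_{\beta,\alpha}((0,1])$ and $\Omega_{\beta,\alpha}=\Omega^{+}_{\beta,\alpha}\cup\Omega^{-}_{\beta,\alpha}$ (the intermediate $\beta$-shift; greedy $\beta$-shift if $\alpha=0$, lazy $\beta$-shift if $\alpha=2-\beta$). A map $T:[0,1]\to[0,1]$ is transitive if for every non-empty open subinterval $J$ of $[0,1]$ there is $m\in\mathbb{N}$ with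 $\bigcup_{i=1}^{m}T^{i}(J)\supseteq(0,1)$. $\{0,1\}^{\mathbb{N}}$ carries the product topology and $\sigma$ is the left shift. A subshift is a closed set $\Omega\subseteq\{0,1\}^{\mathbb{N}}$ with $\sigma(\Omega)\subseteq\Omega$. $\Omega|^{*}$ denotes the set of all finite non-empty words that are prefixes of elements of $\Omega$. A subshift $\Omega$ is a subshift of finite type (SFT) if there is $M\in\mathbb{N}$ such that for all $(\omega_1,\dots,\omega_n),(\xi_1,\dots,\xi_m)\in\Omega|^{*}$ with $n\ge M$: $(\omega_{n-M+1},\dots,\omega_n,\xi_1,\dots,\xi_m)\in\Omega|^{*}$ if and only if $(\omega_1,\dots,\omega_n,\xi_1,\dots,\xi_m)\in\Omega|^{*}$. A subshift is sofic if it is a factor of an SFT (image under a continuous shift-commuting surjection). *)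

theory Defs
  imports "HOL-Analysis.Analysis"
begin

text \<open>The parameters are meant to lie in
  \<open>\<Delta> = {(\<beta>, \<alpha>). \<beta> \<in> {1<..<2} \<and> 0 \<le> \<alpha> \<and> \<alpha> \<le> 2 - \<beta>}\<close>; on that set both maps send \<open>{0..1}\<close> into
  itself, and only their values on \<open>{0..1}\<close> are ever used.\<close>

definition crit :: "real \<Rightarrow> real \<Rightarrow> real" where
  "crit \<beta> \<alpha> = (1 - \<alpha>) / \<beta>"

definition T_plus :: "real \<Rightarrow> real \<Rightarrow> real \<Rightarrow> real" where
  "T_plus \<beta> \<alpha> x = (if x < crit \<beta> \<alpha> then \<beta> * x + \<alpha> else \<beta> * x + \<alpha> - 1)"

definition T_minus :: "real \<Rightarrow> real \<Rightarrow> real \<Rightarrow> real" where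
  "T_minus \<beta> \<alpha> x = (if x \<le> crit \<beta> \<alpha> then \<beta> * x + \<alpha> else \<beta> * x + \<alpha> - 1)"

definition greedy_map :: "real \<Rightarrow> real \<Rightarrow> real" where
  "greedy_map \<beta> = T_plus \<beta> 0"

definition lazy_map :: "real \<Rightarrow> real \<Rightarrow> real" where
  "lazy_map \<beta> = T_minus \<beta> (2 - \<beta>)"

definition transitive_map :: "(real \<Rightarrow> real) \<Rightarrow> bool" where
  "transitive_map T \<longleftrightarrow>
     (\<forall>a b. 0 \<le> a \<and> a < b \<and> b \<le> 1 \<longrightarrow>
        (\<exists>m. {0<..<1} \<subseteq> (\<Union>i\<in>{1..m}. (T ^^ i) ` {a<..<b})))"

text \<open>Sequences over \<open>{0,1}\<close> are functions \<open>nat \<Rightarrow> nat\<close> indexed from 0, so the digit usually written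
  \<open>\<omega>\<^sub>n\<close> with \<open>n \<ge> 1\<close> is \<open>\<omega> (n - 1)\<close>. As \<open>nat\<close> is discrete, the library's product topology on
  \<open>nat \<Rightarrow> nat\<close> induces the usual one on \<open>bin_seqs\<close>, which is a closed subset.\<close>

definition bin_seqs :: "(nat \<Rightarrow> nat) set" where
  "bin_seqs = (UNIV \<rightarrow> {0, 1})"

definition tau_plus :: "real \<Rightarrow> real \<Rightarrow> real \<Rightarrow> nat \<Rightarrow> nat" where
  "tau_plus \<beta> \<alpha> x n = (if (T_plus \<beta> \<alpha> ^^ n) x < crit \<beta> \<alpha> then 0 else 1)"

definition tau_minus :: "real \<Rightarrow> real \<Rightarrow> real \<Rightarrow> nat \<Rightarrow> nat" where
  "tau_minus \<beta> \<alpha> x n = (if (T_minus \<beta> \<alpha> ^^ n) x \<le> crit \<beta> \<alpha> then 0 else 1)"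

definition beta_shift :: "real \<Rightarrow> real \<Rightarrow> (nat \<Rightarrow> nat) set" where
  "beta_shift \<beta> \<alpha> = tau_plus \<beta> \<alpha> ` {0..<1} \<union> tau_minus \<beta> \<alpha> ` {0<..1}"

definition greedy_shift :: "real \<Rightarrow> (nat \<Rightarrow> nat) set" where
  "greedy_shift \<beta> = beta_shift \<beta> 0"

definition lazy_shift :: "real \<Rightarrow> (nat \<Rightarrow> nat) set" where
  "lazy_shift \<beta> = beta_shift \<beta> (2 - \<beta>)"

definition left_shift :: "(nat \<Rightarrow> nat) \<Rightarrow> nat \<Rightarrow> nat" where
  "left_shift \<omega> = (\<lambda>n. \<omega> (Suc n))"

definition subshift :: "(nat \<Rightarrow> nat) set \<Rightarrow> bool" where
  "subshift \<Omega> \<longleftrightarrow> \<Omega> \<subseteq> bin_seqs \<and> closed \<Omega> \<and> left_shift ` \<Omega> \<subseteq> \<Omega>"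

definition prefix_words :: "(nat \<Rightarrow> nat) set \<Rightarrow> nat list set" where
  "prefix_words \<Omega> = {map \<omega> [0..<n] | \<omega> n. \<omega> \<in> \<Omega> \<and> n \<ge> 1}"

text \<open>In the next definition \<open>drop (length u - M) u\<close> is the suffix of length \<open>M\<close> of \<open>u\<close>.\<close>

definition subshift_finite_type :: "(nat \<Rightarrow> nat) set \<Rightarrow> bool" where
  "subshift_finite_type \<Omega> \<longleftrightarrow> subshift \<Omega> \<and>
     (\<exists>M\<ge>1. \<forall>u\<in>prefix_words \<Omega>. \<forall>v\<in>prefix_words \<Omega>. length u \<ge> M \<longrightarrow>
        (drop (length u - M) u @ v \<in> prefix_words \<Omega> \<longleftrightarrow> u @ v \<in> prefix_words \<Omega>))"

definition factor_of :: "(nat \<Rightarrow> nat) set \<Rightarrow> (nat \<Rightarrow> nat) set \<Rightarrow> bool" where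
  "factor_of \<Omega> \<Xi> \<longleftrightarrow>
     (\<exists>\<pi>. continuous_on \<Xi> \<pi> \<and> \<pi> ` \<Xi> = \<Omega> \<and>
        (\<forall>\<xi>\<in>\<Xi>. \<pi> (left_shift \<xi>) = left_shift (\<pi> \<xi>)))"

definition sofic :: "(nat \<Rightarrow> nat) set \<Rightarrow> bool" where
  "sofic \<Omega> \<longleftrightarrow> subshift \<Omega> \<and> (\<exists>\<Xi>. subshift_finite_type \<Xi> \<and> factor_of \<Omega> \<Xi>)"

definition multinacci :: "nat \<Rightarrow> real" where
  "multinacci n = (THE x. 0 < x \<and> 1 = (\<Sum>i=1..n. inverse x ^ i))"

lemma multinacci_ex1:
  assumes "2 \<le> n"
  shows "\<exists>!x::real. 0 < x \<and> 1 = (\<Sum>i=1..n. inverse x ^ i)"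
    and "\<And>x::real. 0 < x \<Longrightarrow> 1 = (\<Sum>i=1..n. inverse x ^ i) \<Longrightarrow> 1 < x \<and> x < 2"
proof -
  let ?f = "\<lambda>x::real. \<Sum>i=1..n. inverse x ^ i"
  have mono: "?f y < ?f x" if "0 < x" "x < y" for x y
    using that assms by (intro sum_strict_mono power_strict_mono) auto
  have "?f 1 = real n" by simp
  then have f1: "?f 1 > 1" using assms by linarith
  have "?f 2 = 1 - inverse 2 ^ n" by (induction n) (auto simp: field_simps)
  then have f2: "?f 2 < 1" by simp
  have "\<exists>x\<ge>1. x \<le> 2 \<and> ?f x = 1"
    using f1 f2 by (intro IVT2') (auto intro!: continuous_intros)
  then obtain x where x: "x \<ge> 1" "?f x = 1" by blast
  show "\<exists>!x::real. 0 < x \<and> 1 = ?f x"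
  proof (rule ex1I[of _ x])
    show "0 < x \<and> 1 = ?f x" using x by simp
    show "y = x" if "0 < y \<and> 1 = ?f y" for y
      using that x mono[of x y] mono[of y x] by (cases x y rule: linorder_cases) auto
  qed
  show "1 < x \<and> x < 2" if "0 < x" "1 = ?f x" for x
  proof -
    have "\<not> x \<le> 1" using that f1 mono[of x 1] by (cases "x = 1") auto
    moreover have "\<not> 2 \<le> x" using that f2 mono[of 2 x] by (cases "x = 2") auto
    ultimately show ?thesis by simp
  qed
qed

lemma multinacci_props:
  assumes "2 \<le> n"
  shows "1 = (\<Sum>i=1..n. inverse (multinacci n) ^ i)" "1 < multinacci n" "multinacci n < 2"
  using theI'[OF multinacci_ex1(1)[OF assms]] multinacci_ex1(2)[OF assms]
  unfolding multinacci_def by blast+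

end

theory Submission
  imports Defs "HOL-Computational_Algebra.Polynomial_Factorial"
    "HOL-Computational_Algebra.Fundamental_Theorem_Algebra"
begin

text \<open>In the coordinate \<open>z = 2x - 1\<close> the symmetric map \<open>T\<close> with slope \<open>\<beta>\<close> is \<open>z \<mapsto> \<beta> z \<plusminus> 1\<close>. On
  \<open>\<bar>z\<bar> \<le> \<beta> - 1\<close> its square is a rescaled copy of the symmetric map with slope \<open>\<beta>\<^sup>2\<close>. For \<open>\<beta>\<^sup>2 < 2\<close> this
  gives an invariant set with a gap, so \<open>T\<close> is not transitive; by induction on \<open>k\<close> the critical orbit is
  periodic, because it is so for the slope \<open>\<gamma>\<^sub>n\<close>, and then the shift is of finite type.

  If the greedy shift were a factor of an SFT, the pigeonhole principle applied to a preimage of the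
  expansion of 1 would make two points of the orbit of 1 equal. This is an integer polynomial equation for
  \<open>\<beta>\<close>, and since \<open>f\<^sub>n(x^(2^k))\<close> is irreducible, where \<open>f\<^sub>n = x^n - x^(n-1) - \<dots> - 1\<close>, it also holds for \<open>-\<beta>\<close>.
  At \<open>-\<beta>\<close> however the orbit polynomials grow exponentially. Irreducibility starts from the Pisot property
  of \<open>\<gamma>\<^sub>n\<close>; passing from \<open>F(x)\<close> to \<open>F(x\<^sup>2)\<close> it could only fail if \<open>F(x) F(-x) \<equiv> \<plusminus>F(x\<^sup>2)\<close> modulo 4, which the
  top coefficients exclude.\<close>


section \<open>Expansions and reflection\<close>

text \<open>The reflection \<open>1 - x\<close> exchanges approach from the left with approach from
  the right, so it must swap the plus and the minus map. For \<alpha> = 0 it links the greedy with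
  the lazy case.\<close>

lemma T_minus_reflect:
  assumes "\<beta> > 0"
  shows "T_minus \<beta> (2 - \<beta> - \<alpha>) (1 - x) = 1 - T_plus \<beta> \<alpha> x"
    and "T_plus \<beta> (2 - \<beta> - \<alpha>) (1 - x) = 1 - T_minus \<beta> \<alpha> x"
    and "1 - x \<le> crit \<beta> (2 - \<beta> - \<alpha>) \<longleftrightarrow> \<not> x < crit \<beta> \<alpha>"
    and "1 - x < crit \<beta> (2 - \<beta> - \<alpha>) \<longleftrightarrow> \<not> x \<le> crit \<beta> \<alpha>"
  using assms by (auto simp: T_minus_def T_plus_def crit_def field_simps)

lemma funpow_reflect:
  fixes S T :: "real \<Rightarrow> real"
  assumes "\<And>x. S (1 - x) = 1 - T x"
  shows "(S ^^ i) (1 - x) = 1 - (T ^^ i) x"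
  by (induction i) (auto simp: assms)

definition flip :: "(nat \<Rightarrow> nat) \<Rightarrow> nat \<Rightarrow> nat" where
  "flip \<omega> = (\<lambda>i. 1 - \<omega> i)"

lemma tau_reflect:
  assumes "\<beta> > 0"
  shows "tau_minus \<beta> (2 - \<beta> - \<alpha>) (1 - x) = flip (tau_plus \<beta> \<alpha> x)"
    and "tau_plus \<beta> (2 - \<beta> - \<alpha>) (1 - x) = flip (tau_minus \<beta> \<alpha> x)"
  unfolding tau_minus_def tau_plus_def flip_def
  by (auto simp: funpow_reflect T_minus_reflect[OF assms])

lemma beta_shift_reflect:
  assumes "\<beta> > 0"
  shows "beta_shift \<beta> (2 - \<beta> - \<alpha>) = flip ` beta_shift \<beta> \<alpha>"
proof -
  have r: "{0<..1} = (\<lambda>x::real. 1 - x) ` {0..<1}" "{0..<1} = (\<lambda>x::real. 1 - x) ` {0<..1}"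
    by auto
  have "tau_minus \<beta> (2 - \<beta> - \<alpha>) ` {0<..1} = flip ` tau_plus \<beta> \<alpha> ` {0..<1}"
    unfolding r(1) image_image by (simp add: tau_reflect[OF assms])
  moreover have "tau_plus \<beta> (2 - \<beta> - \<alpha>) ` {0..<1} = flip ` tau_minus \<beta> \<alpha> ` {0<..1}"
    unfolding r(2) image_image by (simp add: tau_reflect[OF assms])
  ultimately show ?thesis
    unfolding beta_shift_def by (simp add: image_Un Un_commute)
qed

lemma beta_shift_subset_bin_seqs: "beta_shift \<beta> \<alpha> \<subseteq> bin_seqs"
  by (auto simp: beta_shift_def bin_seqs_def tau_plus_def tau_minus_def)

text \<open>Truncated subtraction from 1 is an involution only on the digits 0 and 1.\<close>

lemma flip_flip:
  assumes "\<omega> \<in> bin_seqs"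
  shows "flip (flip \<omega>) = \<omega>"
proof
  fix i
  have "\<omega> i \<in> {0, 1}" using assms unfolding bin_seqs_def by blast
  then show "flip (flip \<omega>) i = \<omega> i" by (auto simp: flip_def)
qed

lemma greedy_shift_eq_flip_lazy_shift:
  assumes "\<beta> > 0"
  shows "greedy_shift \<beta> = flip ` lazy_shift \<beta>"
proof -
  have "lazy_shift \<beta> = flip ` greedy_shift \<beta>"
    using beta_shift_reflect[OF assms, of 0] by (simp add: lazy_shift_def greedy_shift_def)
  moreover have "flip ` flip ` greedy_shift \<beta> = greedy_shift \<beta>"
  proof -
    have "(\<lambda>\<omega>. flip (flip \<omega>)) ` greedy_shift \<beta> = (\<lambda>\<omega>. \<omega>) ` greedy_shift \<beta>"
      using beta_shift_subset_bin_seqs[of \<beta> 0] unfolding greedy_shift_def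
      by (intro image_cong refl flip_flip) blast
    then show ?thesis by (simp add: image_image)
  qed
  ultimately show ?thesis by simp
qed

lemma T_plus_image:
  assumes "1 < \<beta>" "0 \<le> \<alpha>" "\<alpha> \<le> 2 - \<beta>" "x \<in> {0..<1}"
  shows "T_plus \<beta> \<alpha> x \<in> {0..<1}"
proof (cases "x < crit \<beta> \<alpha>")
  case True
  then show ?thesis using assms by (auto simp: T_plus_def crit_def field_simps)
next
  case False
  have "\<beta> * x < \<beta>" using assms by simp
  then have "\<beta> * x + \<alpha> - 1 < 1" using assms(3) by linarith
  moreover have "0 \<le> \<beta> * x + \<alpha> - 1" using False assms by (simp add: crit_def field_simps)
  ultimately show ?thesis using False assms by (simp add: T_plus_def)
qed

lemma T_minus_image:
  assumes "1 < \<beta>" "0 \<le> \<alpha>" "\<alpha> \<le> 2 - \<beta>" "x \<in> {0<..1}"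
  shows "T_minus \<beta> \<alpha> x \<in> {0<..1}"
  using T_plus_image[of \<beta> "2 - \<beta> - \<alpha>" "1 - x"] T_minus_reflect(2)[of \<beta> \<alpha> x] assms by auto

lemma T_plus_funpow_image:
  assumes "1 < \<beta>" "0 \<le> \<alpha>" "\<alpha> \<le> 2 - \<beta>" "x \<in> {0..<1}"
  shows "(T_plus \<beta> \<alpha> ^^ i) x \<in> {0..<1}"
  using assms(4) by (induction i) (use T_plus_image[OF assms(1-3)] in auto)

lemma T_minus_funpow_image:
  assumes "1 < \<beta>" "0 \<le> \<alpha>" "\<alpha> \<le> 2 - \<beta>" "x \<in> {0<..1}"
  shows "(T_minus \<beta> \<alpha> ^^ i) x \<in> {0<..1}"
  using assms(4) by (induction i) (use T_minus_image[OF assms(1-3)] in auto)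

lemma T_plus_step: "T_plus \<beta> \<alpha> ((T_plus \<beta> \<alpha> ^^ i) x) = \<beta> * (T_plus \<beta> \<alpha> ^^ i) x + \<alpha> - tau_plus \<beta> \<alpha> x i"
  by (simp add: T_plus_def tau_plus_def)

lemma T_minus_step: "T_minus \<beta> \<alpha> ((T_minus \<beta> \<alpha> ^^ i) x) = \<beta> * (T_minus \<beta> \<alpha> ^^ i) x + \<alpha> - tau_minus \<beta> \<alpha> x i"
  by (simp add: T_minus_def tau_minus_def)

lemma left_shift_funpow: "(left_shift ^^ i) \<omega> = (\<lambda>l. \<omega> (i + l))"
  by (induction i arbitrary: \<omega>) (auto simp: left_shift_def funpow_swap1 fun_eq_iff)

lemma tau_plus_funpow: "tau_plus \<beta> \<alpha> ((T_plus \<beta> \<alpha> ^^ i) x) = (left_shift ^^ i) (tau_plus \<beta> \<alpha> x)"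
  by (simp add: left_shift_funpow tau_plus_def fun_eq_iff add.commute[of i] funpow_add)

lemma tau_minus_funpow: "tau_minus \<beta> \<alpha> ((T_minus \<beta> \<alpha> ^^ i) x) = (left_shift ^^ i) (tau_minus \<beta> \<alpha> x)"
  by (simp add: left_shift_funpow tau_minus_def fun_eq_iff add.commute[of i] funpow_add)

lemma beta_shift_shift_invariant:
  assumes "1 < \<beta>" "0 \<le> \<alpha>" "\<alpha> \<le> 2 - \<beta>"
  shows "left_shift ` beta_shift \<beta> \<alpha> \<subseteq> beta_shift \<beta> \<alpha>"
proof -
  have "left_shift (tau_plus \<beta> \<alpha> x) = tau_plus \<beta> \<alpha> (T_plus \<beta> \<alpha> x)" for x
    using tau_plus_funpow[of \<beta> \<alpha> 1 x] by simp
  moreover have "left_shift (tau_minus \<beta> \<alpha> x) = tau_minus \<beta> \<alpha> (T_minus \<beta> \<alpha> x)" for x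
    using tau_minus_funpow[of \<beta> \<alpha> 1 x] by simp
  ultimately show ?thesis
    using T_plus_image[OF assms] T_minus_image[OF assms] unfolding beta_shift_def by auto
qed

section \<open>One-sided limits of expansions and closedness of the shift\<close>

text \<open>\<open>T_plus\<close> is increasing and continuous from the right, so a point slightly
  to the right of \<open>x\<close> takes the same branches as \<open>x\<close> for any fixed number
  of steps.\<close>

lemma tau_plus_eq_near_right:
  assumes "1 < \<beta>"
  shows "\<exists>\<delta>>0. \<forall>y. x \<le> y \<and> y < x + \<delta> \<longrightarrow> (\<forall>i<m. tau_plus \<beta> \<alpha> y i = tau_plus \<beta> \<alpha> x i)"
proof (induction m arbitrary: x)
  case 0
  show ?case by (intro exI[of _ 1]) auto
next
  case (Suc m)
  from Suc.IH[of "T_plus \<beta> \<alpha> x"] obtain \<delta> where d: "\<delta> > 0"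
    "\<And>y i. T_plus \<beta> \<alpha> x \<le> y \<Longrightarrow> y < T_plus \<beta> \<alpha> x + \<delta> \<Longrightarrow> i < m \<Longrightarrow> tau_plus \<beta> \<alpha> y i = tau_plus \<beta> \<alpha> (T_plus \<beta> \<alpha> x) i"
    by blast
  \<comment> \<open>Division by \<beta> makes up for the expansion in one step; if \<open>x\<close>
    is left of the critical point, \<open>y\<close> must also stay left of it.\<close>
  define e where "e = (if x < crit \<beta> \<alpha> then min (\<delta> / \<beta>) (crit \<beta> \<alpha> - x) else \<delta> / \<beta>)"
  have "e > 0" using d assms by (auto simp: e_def)
  moreover have "tau_plus \<beta> \<alpha> y i = tau_plus \<beta> \<alpha> x i" if y: "x \<le> y" "y < x + e" and i: "i < Suc m" for y i
  proof -
    have c: "y < crit \<beta> \<alpha> \<longleftrightarrow> x < crit \<beta> \<alpha>" using y by (auto simp: e_def split: if_splits)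
    have "y < x + \<delta> / \<beta>" using y by (auto simp: e_def split: if_splits)
    then have "\<beta> * y < \<beta> * x + \<delta>" using assms by (simp add: field_simps)
    moreover have "\<beta> * x \<le> \<beta> * y" using y assms by simp
    ultimately have "T_plus \<beta> \<alpha> x \<le> T_plus \<beta> \<alpha> y" "T_plus \<beta> \<alpha> y < T_plus \<beta> \<alpha> x + \<delta>"
      using c by (auto simp: T_plus_def)
    then have "\<And>i. i < m \<Longrightarrow> tau_plus \<beta> \<alpha> (T_plus \<beta> \<alpha> y) i = tau_plus \<beta> \<alpha> (T_plus \<beta> \<alpha> x) i"
      using d by blast
    then have "\<And>i. i < m \<Longrightarrow> tau_plus \<beta> \<alpha> y (Suc i) = tau_plus \<beta> \<alpha> x (Suc i)"
      by (simp add: tau_plus_def funpow_swap1)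
    moreover have "tau_plus \<beta> \<alpha> y 0 = tau_plus \<beta> \<alpha> x 0" using c by (simp add: tau_plus_def)
    ultimately show ?thesis using i by (cases i) auto
  qed
  ultimately show ?case by blast
qed

text \<open>Points just left of the critical point use the left branch, as \<open>T_minus\<close>
  does at the critical point itself. Hence plus expansions tend to the minus expansion under
  approach from below.\<close>

lemma tau_plus_eq_near_left:
  assumes "1 < \<beta>"
  shows "\<exists>\<delta>>0. \<forall>y. x - \<delta> < y \<and> y < x \<longrightarrow> (\<forall>i<m. tau_plus \<beta> \<alpha> y i = tau_minus \<beta> \<alpha> x i)"
proof (induction m arbitrary: x)
  case 0
  show ?case by (intro exI[of _ 1]) auto
next
  case (Suc m)
  from Suc.IH[of "T_minus \<beta> \<alpha> x"] obtain \<delta> where d: "\<delta> > 0"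
    "\<And>y i. T_minus \<beta> \<alpha> x - \<delta> < y \<Longrightarrow> y < T_minus \<beta> \<alpha> x \<Longrightarrow> i < m \<Longrightarrow> tau_plus \<beta> \<alpha> y i = tau_minus \<beta> \<alpha> (T_minus \<beta> \<alpha> x) i"
    by blast
  define e where "e = (if x \<le> crit \<beta> \<alpha> then \<delta> / \<beta> else min (\<delta> / \<beta>) (x - crit \<beta> \<alpha>))"
  have "e > 0" using d assms by (auto simp: e_def)
  moreover have "tau_plus \<beta> \<alpha> y i = tau_minus \<beta> \<alpha> x i" if y: "x - e < y" "y < x" and i: "i < Suc m" for y i
  proof -
    have c: "y < crit \<beta> \<alpha> \<longleftrightarrow> x \<le> crit \<beta> \<alpha>" using y by (auto simp: e_def split: if_splits)
    have "x - \<delta> / \<beta> < y" using y by (auto simp: e_def split: if_splits)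
    then have "\<beta> * x - \<delta> < \<beta> * y" using assms by (simp add: field_simps)
    moreover have "\<beta> * y < \<beta> * x" using y assms by simp
    ultimately have "T_minus \<beta> \<alpha> x - \<delta> < T_plus \<beta> \<alpha> y" "T_plus \<beta> \<alpha> y < T_minus \<beta> \<alpha> x"
      using c by (auto simp: T_plus_def T_minus_def)
    then have "\<And>i. i < m \<Longrightarrow> tau_plus \<beta> \<alpha> (T_plus \<beta> \<alpha> y) i = tau_minus \<beta> \<alpha> (T_minus \<beta> \<alpha> x) i"
      using d by blast
    then have "\<And>i. i < m \<Longrightarrow> tau_plus \<beta> \<alpha> y (Suc i) = tau_minus \<beta> \<alpha> x (Suc i)"
      by (simp add: tau_plus_def tau_minus_def funpow_swap1)
    moreover have "tau_plus \<beta> \<alpha> y 0 = tau_minus \<beta> \<alpha> x 0" using c by (simp add: tau_plus_def tau_minus_def)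
    ultimately show ?thesis using i by (cases i) auto
  qed
  ultimately show ?case by blast
qed

lemma beta_shift_prefix:
  assumes "1 < \<beta>" "\<omega> \<in> beta_shift \<beta> \<alpha>"
  shows "\<exists>x\<in>{0..<1}. \<forall>i<m. tau_plus \<beta> \<alpha> x i = \<omega> i"
proof -
  consider x where "x \<in> {0..<1}" "\<omega> = tau_plus \<beta> \<alpha> x" | x where "x \<in> {0<..1}" "\<omega> = tau_minus \<beta> \<alpha> x"
    using assms(2) by (auto simp: beta_shift_def)
  then show ?thesis
  proof cases
    case 2
    from tau_plus_eq_near_left[OF assms(1), of x m \<alpha>] obtain \<delta> where d: "\<delta> > 0"
      "\<And>y i. x - \<delta> < y \<Longrightarrow> y < x \<Longrightarrow> i < m \<Longrightarrow> tau_plus \<beta> \<alpha> y i = tau_minus \<beta> \<alpha> x i" by blast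
    have "max 0 (x - \<delta>) < x" using 2 d by auto
    then obtain y where y: "max 0 (x - \<delta>) < y" "y < x" using dense by blast
    show ?thesis using d(2)[of y] y 2 by (intro bexI[of _ y]) auto
  qed blast
qed

text \<open>A subsequence of the points realising longer and longer prefixes converges to some
  \<open>x\<close>. If it lies at or above \<open>x\<close> infinitely often, the limit is the plus
  expansion of \<open>x\<close>, otherwise the minus expansion.\<close>

lemma beta_shift_memI:
  assumes "1 < \<beta>" "\<And>m. \<exists>x\<in>{0..<1}. \<forall>i<m. tau_plus \<beta> \<alpha> x i = \<omega> i"
  shows "\<omega> \<in> beta_shift \<beta> \<alpha>"
proof -
  obtain X where X: "\<And>m. X m \<in> {0..<1}" "\<And>m i. i < m \<Longrightarrow> tau_plus \<beta> \<alpha> (X m) i = \<omega> i"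
    using assms(2) by metis
  have "\<forall>m. X m \<in> {0..1}" using X(1) by (force simp: less_imp_le)
  then obtain x r where x: "x \<in> {0..1}" and r: "strict_mono r" and lim: "(X \<circ> r) \<longlonglongrightarrow> x"
    using compact_Icc[of 0 "1::real"] unfolding compact_eq_seq_compact_metric seq_compact_def by blast
  have rge: "m \<le> r m" for m using r by (rule strict_mono_imp_increasing)
  have close: "eventually (\<lambda>j. \<bar>X (r j) - x\<bar> < \<delta> \<and> j \<ge> m) sequentially" if "\<delta> > 0" for \<delta> m
    using tendstoD[OF lim that] eventually_ge_at_top[of m] by eventually_elim (auto simp: dist_real_def)
  show ?thesis
  proof (cases "frequently (\<lambda>j. x \<le> X (r j)) sequentially")
    case True
    \<comment> \<open>A single index with \<open>x \<le> X (r j)\<close> excludes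
      \<open>x = 1\<close>, which has no plus expansion in the shift by definition.\<close>
    from frequently_ex[OF this] obtain j where "x \<le> X (r j)" by blast
    then have "x \<in> {0..<1}" using x X(1)[of "r j"] by auto
    moreover have "tau_plus \<beta> \<alpha> x i = \<omega> i" for i
    proof -
      obtain \<delta> where d: "\<delta> > 0" "\<And>y. x \<le> y \<Longrightarrow> y < x + \<delta> \<Longrightarrow> tau_plus \<beta> \<alpha> y i = tau_plus \<beta> \<alpha> x i"
        using tau_plus_eq_near_right[OF assms(1), of x "Suc i" \<alpha>] by blast
      obtain j where j: "x \<le> X (r j)" "\<bar>X (r j) - x\<bar> < \<delta>" "j \<ge> Suc i"
        using frequently_ex[OF frequently_eventually_conj[OF True close[OF d(1), of "Suc i"]]] by auto
      show ?thesis using d(2)[of "X (r j)"] X(2)[of i "r j"] rge[of j] j by auto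
    qed
    moreover from this have "\<omega> = tau_plus \<beta> \<alpha> x" by (simp add: fun_eq_iff)
    ultimately show ?thesis unfolding beta_shift_def by blast
  next
    case False
    then have ev: "eventually (\<lambda>j. X (r j) < x) sequentially" by (simp add: not_frequently not_le)
    from eventually_happens[OF this] obtain j where "X (r j) < x" by auto
    then have "x \<in> {0<..1}" using x X(1)[of "r j"] by auto
    moreover have "tau_minus \<beta> \<alpha> x i = \<omega> i" for i
    proof -
      obtain \<delta> where d: "\<delta> > 0" "\<And>y. x - \<delta> < y \<Longrightarrow> y < x \<Longrightarrow> tau_plus \<beta> \<alpha> y i = tau_minus \<beta> \<alpha> x i"
        using tau_plus_eq_near_left[OF assms(1), of x "Suc i" \<alpha>] by blast
      obtain j where j: "X (r j) < x" "\<bar>X (r j) - x\<bar> < \<delta>" "j \<ge> Suc i"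
        using eventually_happens[OF eventually_conj[OF ev close[OF d(1), of "Suc i"]]] by auto
      show ?thesis using d(2)[of "X (r j)"] X(2)[of i "r j"] rge[of j] j by auto
    qed
    moreover from this have "\<omega> = tau_minus \<beta> \<alpha> x" by (simp add: fun_eq_iff)
    ultimately show ?thesis unfolding beta_shift_def by blast
  qed
qed

section \<open>Subshifts of finite type from hitting the critical point\<close>

lemma seq_tendsto_iff:
  fixes X :: "'a \<Rightarrow> 'b \<Rightarrow> 'c :: discrete_topology"
  shows "(X \<longlongrightarrow> \<omega>) F \<longleftrightarrow> (\<forall>i. eventually (\<lambda>n. X n i = \<omega> i) F)"
  using limitin_componentwise[of "\<lambda>_::'b. euclidean :: 'c topology" UNIV X \<omega> F]
  by (simp add: euclidean_product_topology tendsto_discrete)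

text \<open>Convergence in a product of discrete spaces is eventual agreement in each digit, so
  closedness can be tested on initial segments.\<close>

lemma closed_seq_iff:
  fixes \<Omega> :: "(nat \<Rightarrow> nat) set"
  shows "closed \<Omega> \<longleftrightarrow> (\<forall>\<omega>. (\<forall>m. \<exists>\<xi>\<in>\<Omega>. \<forall>i<m. \<xi> i = \<omega> i) \<longrightarrow> \<omega> \<in> \<Omega>)"
proof (intro iffI allI impI)
  fix \<omega> assume "closed \<Omega>" and ex: "\<forall>m. \<exists>\<xi>\<in>\<Omega>. \<forall>i<m. \<xi> i = \<omega> i"
  from ex obtain X where X: "\<And>m. X m \<in> \<Omega>" "\<And>m i. i < m \<Longrightarrow> X m i = \<omega> i" by metis
  have "eventually (\<lambda>m. X m i = \<omega> i) sequentially" for i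
    using eventually_gt_at_top[of i] by eventually_elim (rule X(2))
  then have "X \<longlonglongrightarrow> \<omega>" by (simp add: seq_tendsto_iff)
  then show "\<omega> \<in> \<Omega>" using \<open>closed \<Omega>\<close> X(1) unfolding closed_sequential_limits by blast
next
  assume *: "\<forall>\<omega>. (\<forall>m. \<exists>\<xi>\<in>\<Omega>. \<forall>i<m. \<xi> i = \<omega> i) \<longrightarrow> \<omega> \<in> \<Omega>"
  show "closed \<Omega>"
    unfolding closed_sequential_limits
  proof (intro allI impI, elim conjE)
    fix X \<omega> assume X: "\<forall>n. X n \<in> \<Omega>" "X \<longlonglongrightarrow> \<omega>"
    have "\<exists>\<xi>\<in>\<Omega>. \<forall>i<m. \<xi> i = \<omega> i" for m
    proof -
      have "eventually (\<lambda>n. \<forall>i\<in>{..<m}. X n i = \<omega> i) sequentially"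
        using X(2) by (intro eventually_ball_finite) (auto simp: seq_tendsto_iff)
      then show ?thesis using X(1) by (auto dest!: eventually_happens)
    qed
    with * show "\<omega> \<in> \<Omega>" by blast
  qed
qed

lemma subshift_beta_shift:
  assumes "1 < \<beta>" "0 \<le> \<alpha>" "\<alpha> \<le> 2 - \<beta>"
  shows "subshift (beta_shift \<beta> \<alpha>)"
  unfolding subshift_def closed_seq_iff
proof (intro conjI allI impI)
  fix \<omega> assume *: "\<forall>m. \<exists>\<xi>\<in>beta_shift \<beta> \<alpha>. \<forall>i<m. \<xi> i = \<omega> i"
  show "\<omega> \<in> beta_shift \<beta> \<alpha>"
  proof (rule beta_shift_memI[OF assms(1)])
    fix m
    from * obtain \<xi> where \<xi>: "\<xi> \<in> beta_shift \<beta> \<alpha>" "\<forall>i<m. \<xi> i = \<omega> i" by blast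
    from beta_shift_prefix[OF assms(1) this(1)] obtain x
      where "x \<in> {0..<1}" "\<forall>i<m. tau_plus \<beta> \<alpha> x i = \<xi> i" by blast
    with \<xi>(2) show "\<exists>x\<in>{0..<1}. \<forall>i<m. tau_plus \<beta> \<alpha> x i = \<omega> i"
      by (intro bexI[of _ x]) simp_all
  qed
qed (fact beta_shift_subset_bin_seqs beta_shift_shift_invariant[OF assms])+

lemma prefix_words_iff:
  "w \<in> prefix_words \<Omega> \<longleftrightarrow> w \<noteq> [] \<and> (\<exists>\<omega>\<in>\<Omega>. \<forall>i<length w. \<omega> i = w ! i)"
proof
  assume "w \<in> prefix_words \<Omega>"
  then obtain \<omega> n where "w = map \<omega> [0..<n]" "\<omega> \<in> \<Omega>" "n \<ge> 1" unfolding prefix_words_def by blast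
  then show "w \<noteq> [] \<and> (\<exists>\<omega>\<in>\<Omega>. \<forall>i<length w. \<omega> i = w ! i)" by auto
next
  assume *: "w \<noteq> [] \<and> (\<exists>\<omega>\<in>\<Omega>. \<forall>i<length w. \<omega> i = w ! i)"
  then obtain \<omega> where \<omega>: "\<omega> \<in> \<Omega>" "\<forall>i<length w. \<omega> i = w ! i" by blast
  then have "w = map \<omega> [0..<length w]" by (intro nth_equalityI) simp_all
  with * \<omega>(1) show "w \<in> prefix_words \<Omega>"
    unfolding prefix_words_def by (intro CollectI exI[of _ \<omega>] exI[of _ "length w"]) (simp add: Suc_le_eq)
qed

text \<open>While the digits of \<open>x\<close> and \<open>y\<close> agree, \<open>c\<close> lies
  on the same branch and the order \<open>x < c \<le> y\<close> is preserved. When \<open>c\<close>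
  arrives at the critical point, this order makes the digits differ.\<close>

lemma tau_plus_separates:
  assumes "\<beta> > 0" "x < c" "c \<le> y" "(T_plus \<beta> \<alpha> ^^ j) c = crit \<beta> \<alpha>"
  shows "\<exists>i\<le>j. tau_plus \<beta> \<alpha> x i \<noteq> tau_plus \<beta> \<alpha> y i"
  using assms(2-4)
proof (induction j arbitrary: x c y)
  case 0
  then show ?case by (auto simp: tau_plus_def)
next
  case (Suc j)
  show ?case
  proof (cases "x < crit \<beta> \<alpha> \<longleftrightarrow> y < crit \<beta> \<alpha>")
    case True
    then have "T_plus \<beta> \<alpha> x < T_plus \<beta> \<alpha> c" "T_plus \<beta> \<alpha> c \<le> T_plus \<beta> \<alpha> y"
      using Suc.prems assms(1) by (auto simp: T_plus_def)
    moreover have "(T_plus \<beta> \<alpha> ^^ j) (T_plus \<beta> \<alpha> c) = crit \<beta> \<alpha>"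
      using Suc.prems by (simp add: funpow_swap1)
    ultimately obtain i where "i \<le> j" "tau_plus \<beta> \<alpha> (T_plus \<beta> \<alpha> x) i \<noteq> tau_plus \<beta> \<alpha> (T_plus \<beta> \<alpha> y) i"
      using Suc.IH by blast
    then show ?thesis
      by (intro exI[of _ "Suc i"]) (simp add: tau_plus_def funpow_swap1)
  next
    case False
    then show ?thesis by (intro exI[of _ 0]) (auto simp: tau_plus_def)
  qed
qed

text \<open>The points \<open>\<alpha>\<close> and \<open>\<beta> + \<alpha> - 1\<close> bound the images of the two branches. Once their orbits hit the critical
  point, no cylinder of length \<open>M\<close> contains either of them in its interior, so each such cylinder lies
  entirely inside or outside of a branch image.\<close>

locale intermediate_markov =
  fixes \<beta> \<alpha> :: real and M j0 j1 :: nat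
  assumes params: "1 < \<beta>" "0 \<le> \<alpha>" "\<alpha> \<le> 2 - \<beta>"
    and hit0: "(T_plus \<beta> \<alpha> ^^ j0) \<alpha> = crit \<beta> \<alpha>" "j0 < M"
    and hit1: "(T_plus \<beta> \<alpha> ^^ j1) (\<beta> + \<alpha> - 1) = crit \<beta> \<alpha>" "j1 < M"
begin

lemma same_side:
  assumes "(T_plus \<beta> \<alpha> ^^ j) c = crit \<beta> \<alpha>" "j < M" "\<forall>i<M. tau_plus \<beta> \<alpha> x i = tau_plus \<beta> \<alpha> y i"
  shows "x < c \<longleftrightarrow> y < c"
proof -
  have "\<not> (u < c \<and> c \<le> v)" if "\<forall>i<M. tau_plus \<beta> \<alpha> u i = tau_plus \<beta> \<alpha> v i" for u v
  proof
    assume "u < c \<and> c \<le> v"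
    then obtain i where "i \<le> j" "tau_plus \<beta> \<alpha> u i \<noteq> tau_plus \<beta> \<alpha> v i"
      using tau_plus_separates[of \<beta> u c v j \<alpha>] assms(1) params by auto
    with that assms(2) show False by simp
  qed
  from this[of x y] this[of y x] assms(3) show ?thesis by (auto simp: not_less)
qed

text \<open>The branches map [0,1) onto [\<alpha>,1) and [0,\<beta>+\<alpha>-1). As \<open>x\<close>
  is on the same side of the relevant endpoint as the image of \<open>y\<close>, it has a preimage
  on the branch of \<open>y\<close>.\<close>

lemma pullback_step:
  assumes x: "x \<in> {0..<1}" and y: "y \<in> {0..<1}"
    and eq: "\<forall>i<M. tau_plus \<beta> \<alpha> (T_plus \<beta> \<alpha> y) i = tau_plus \<beta> \<alpha> x i"
  shows "\<exists>z\<in>{0..<1}. T_plus \<beta> \<alpha> z = x \<and> tau_plus \<beta> \<alpha> z 0 = tau_plus \<beta> \<alpha> y 0"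
proof (cases "y < crit \<beta> \<alpha>")
  case True
  moreover have "\<beta> * y \<ge> 0" using y params by simp
  ultimately have "\<not> T_plus \<beta> \<alpha> y < \<alpha>" by (simp add: T_plus_def)
  then have "\<alpha> \<le> x" using same_side[OF hit0 eq] by simp
  define z where "z = (x - \<alpha>) / \<beta>"
  have "z < crit \<beta> \<alpha>" using x params by (simp add: z_def crit_def divide_strict_right_mono)
  moreover have "z \<in> {0..<1}" using x params \<open>\<alpha> \<le> x\<close> by (auto simp: z_def)
  moreover have "T_plus \<beta> \<alpha> z = x" using \<open>z < crit \<beta> \<alpha>\<close> params by (simp add: T_plus_def z_def)
  ultimately show ?thesis using True by (intro bexI[of _ z]) (auto simp: tau_plus_def)
next
  case False
  have "\<beta> * y < \<beta>" using y params by simp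
  then have "T_plus \<beta> \<alpha> y < \<beta> + \<alpha> - 1" using False by (simp add: T_plus_def)
  then have "x < \<beta> + \<alpha> - 1" using same_side[OF hit1 eq] by simp
  define z where "z = (x + 1 - \<alpha>) / \<beta>"
  have "\<not> z < crit \<beta> \<alpha>" using x params by (simp add: z_def crit_def divide_right_mono not_less)
  moreover have "z \<in> {0..<1}" using x params \<open>x < \<beta> + \<alpha> - 1\<close> by (auto simp: z_def)
  moreover have "T_plus \<beta> \<alpha> z = x" using \<open>\<not> z < crit \<beta> \<alpha>\<close> params by (simp add: T_plus_def z_def)
  ultimately show ?thesis using False by (intro bexI[of _ z]) (auto simp: tau_plus_def)
qed

lemma pullback:
  assumes "x \<in> {0..<1}" "y \<in> {0..<1}"
    and "\<forall>i<M. tau_plus \<beta> \<alpha> ((T_plus \<beta> \<alpha> ^^ m) y) i = tau_plus \<beta> \<alpha> x i"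
  shows "\<exists>z\<in>{0..<1}. (T_plus \<beta> \<alpha> ^^ m) z = x \<and> (\<forall>i<m. tau_plus \<beta> \<alpha> z i = tau_plus \<beta> \<alpha> y i)"
  using assms(2,3)
proof (induction m arbitrary: y)
  case 0
  then show ?case using assms(1) by auto
next
  case (Suc m)
  let ?T = "T_plus \<beta> \<alpha>" and ?\<tau> = "tau_plus \<beta> \<alpha>"
  have shift: "?\<tau> (?T x) i = ?\<tau> x (Suc i)" for x i by (simp add: tau_plus_def funpow_swap1)
  have "?T y \<in> {0..<1}" using T_plus_image[OF params] Suc.prems(1) by blast
  moreover have "(?T ^^ m) (?T y) = (?T ^^ Suc m) y" by (simp add: funpow_swap1)
  ultimately obtain z where z: "z \<in> {0..<1}" "(?T ^^ m) z = x" "\<forall>i<m. ?\<tau> z i = ?\<tau> (?T y) i"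
    using Suc.IH[of "?T y"] Suc.prems(2) by metis
  \<comment> \<open>Up to position \<open>m\<close> the digits agree by the choice of
    \<open>z\<close>; from there on they are initial digits of the two points assumed to agree on
    \<open>M\<close> places.\<close>
  have "?\<tau> (?T y) i = ?\<tau> z i" if "i < M" for i
  proof (cases "i < m")
    case False
    then have "?\<tau> z i = ?\<tau> x (i - m)"
      using tau_plus_funpow[of \<beta> \<alpha> m z] z(2) by (simp add: left_shift_funpow)
    moreover have "?\<tau> (?T y) i = ?\<tau> ((?T ^^ Suc m) y) (i - m)"
      using False tau_plus_funpow[of \<beta> \<alpha> m "?T y"] by (simp add: left_shift_funpow funpow_swap1)
    moreover have "i - m < M" using that by simp
    ultimately show ?thesis using Suc.prems(2) by simp
  qed (use z in simp)
  then obtain z' where z': "z' \<in> {0..<1}" "?T z' = z" "?\<tau> z' 0 = ?\<tau> y 0"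
    using pullback_step[OF z(1) Suc.prems(1)] by blast
  have "?\<tau> z' i = ?\<tau> y i" if "i < Suc m" for i
    using that z' z(3) shift[of z'] shift[of y] by (cases i) auto
  moreover have "(?T ^^ Suc m) z' = x" using z' z by (simp add: funpow_swap1)
  ultimately show ?case using z' by blast
qed

lemma subshift_finite_type_beta_shift: "subshift_finite_type (beta_shift \<beta> \<alpha>)"
  unfolding subshift_finite_type_def
proof (intro conjI exI[of _ M] ballI impI)
  show "subshift (beta_shift \<beta> \<alpha>)" using params by (rule subshift_beta_shift)
  show "1 \<le> M" using hit0(2) by simp
  fix u v assume u: "u \<in> prefix_words (beta_shift \<beta> \<alpha>)" and v: "v \<in> prefix_words (beta_shift \<beta> \<alpha>)"
    and len: "M \<le> length u"
  define m where "m = length u - M"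
  have word: "w \<in> prefix_words (beta_shift \<beta> \<alpha>) \<longleftrightarrow> w \<noteq> [] \<and> (\<exists>x\<in>{0..<1}. \<forall>i<length w. tau_plus \<beta> \<alpha> x i = w ! i)"
    for w
  proof -
    have "(\<exists>\<omega>\<in>beta_shift \<beta> \<alpha>. \<forall>i<length w. \<omega> i = w ! i) \<longleftrightarrow>
      (\<exists>x\<in>{0..<1}. \<forall>i<length w. tau_plus \<beta> \<alpha> x i = w ! i)" (is "?L \<longleftrightarrow> ?R")
    proof
      assume ?L
      then obtain \<omega> where \<omega>: "\<omega> \<in> beta_shift \<beta> \<alpha>" "\<forall>i<length w. \<omega> i = w ! i" by blast
      from beta_shift_prefix[OF params(1) this(1)] obtain x
        where "x \<in> {0..<1}" "\<forall>i<length w. tau_plus \<beta> \<alpha> x i = \<omega> i" by blast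
      with \<omega>(2) show ?R by (intro bexI[of _ x]) simp_all
    qed (auto simp: beta_shift_def)
    then show ?thesis by (simp add: prefix_words_iff)
  qed
  have drop_nth: "(drop m u @ v) ! i = (u @ v) ! (m + i)" for i
    using len by (auto simp: nth_append m_def)
  have "drop m u @ v \<in> prefix_words (beta_shift \<beta> \<alpha>) \<longleftrightarrow> u @ v \<in> prefix_words (beta_shift \<beta> \<alpha>)"
  proof
    assume "drop m u @ v \<in> prefix_words (beta_shift \<beta> \<alpha>)"
    then obtain x where x: "x \<in> {0..<1}" "\<forall>i<M + length v. tau_plus \<beta> \<alpha> x i = (u @ v) ! (m + i)"
      using len unfolding word drop_nth by (auto simp: m_def)
    obtain y where y: "y \<in> {0..<1}" "\<forall>i<length u. tau_plus \<beta> \<alpha> y i = u ! i"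
      using u unfolding word by blast
    \<comment> \<open>\<open>y\<close> follows \<open>u\<close>, and after \<open>m\<close> steps it
      shares its next \<open>M\<close> digits with \<open>x\<close>, which follows the suffix of
      \<open>u\<close> and then \<open>v\<close>. Pulling \<open>x\<close> back along
      \<open>y\<close> yields a point that follows all of \<open>u @ v\<close>.\<close>
    have "\<forall>i<M. tau_plus \<beta> \<alpha> ((T_plus \<beta> \<alpha> ^^ m) y) i = tau_plus \<beta> \<alpha> x i"
      using x(2) y(2) len by (auto simp: tau_plus_funpow left_shift_funpow m_def nth_append)
    from pullback[OF x(1) y(1) this] obtain z where z: "z \<in> {0..<1}" "(T_plus \<beta> \<alpha> ^^ m) z = x"
      "\<forall>i<m. tau_plus \<beta> \<alpha> z i = tau_plus \<beta> \<alpha> y i" by blast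
    have "tau_plus \<beta> \<alpha> z i = (u @ v) ! i" if "i < length (u @ v)" for i
    proof (cases "i < m")
      case True
      then show ?thesis using z(3) y(2) by (auto simp: m_def nth_append)
    next
      case False
      then have "tau_plus \<beta> \<alpha> z i = tau_plus \<beta> \<alpha> x (i - m)"
        using tau_plus_funpow[of \<beta> \<alpha> m z] z(2) by (simp add: left_shift_funpow)
      moreover have "i - m < M + length v" using that len False by (auto simp: m_def)
      ultimately show ?thesis using x(2) False by simp
    qed
    then show "u @ v \<in> prefix_words (beta_shift \<beta> \<alpha>)"
      using z(1) u unfolding word[of "u @ v"] by (intro conjI bexI[of _ z]) (auto simp: prefix_words_iff)
  next
    assume "u @ v \<in> prefix_words (beta_shift \<beta> \<alpha>)"
    then obtain x where x: "x \<in> {0..<1}" "\<forall>i<length (u @ v). tau_plus \<beta> \<alpha> x i = (u @ v) ! i"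
      unfolding word by blast
    have "tau_plus \<beta> \<alpha> ((T_plus \<beta> \<alpha> ^^ m) x) i = (drop m u @ v) ! i" if "i < length (drop m u @ v)" for i
      using x(2) that len unfolding drop_nth by (simp add: tau_plus_funpow left_shift_funpow m_def)
    then show "drop m u @ v \<in> prefix_words (beta_shift \<beta> \<alpha>)"
      using T_plus_funpow_image[OF params x(1), of m] v unfolding word by blast
  qed
  then show "drop (length u - M) u @ v \<in> prefix_words (beta_shift \<beta> \<alpha>) \<longleftrightarrow> u @ v \<in> prefix_words (beta_shift \<beta> \<alpha>)"
    by (simp add: m_def)
qed

end

section \<open>Renormalisation of the symmetric map\<close>

lemma multinacci_equation_iff:
  fixes x :: real
  assumes "0 < x"
  shows "1 = (\<Sum>i=1..n. inverse x ^ i) \<longleftrightarrow> x ^ n = (\<Sum>i<n. x ^ i)"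
proof -
  have "x ^ n * (\<Sum>i=1..n. inverse x ^ i) = (\<Sum>i=1..n. x ^ (n - i))"
    unfolding sum_distrib_left
    using assms by (intro sum.cong refl) (simp add: power_diff power_inverse divide_inverse)
  also have "\<dots> = (\<Sum>i<n. x ^ i)"
    by (rule sum.reindex_bij_witness[of _ "\<lambda>i. n - i" "\<lambda>i. n - i"]) auto
  finally have "x ^ n * (\<Sum>i=1..n. inverse x ^ i) = (\<Sum>i<n. x ^ i)" .
  then show ?thesis using assms by (metis mult.right_neutral mult_cancel_left power_not_zero less_irrefl)
qed

lemma multinacci_power:
  assumes "2 \<le> n"
  shows "multinacci n ^ n = (\<Sum>i<n. multinacci n ^ i)"
  using multinacci_equation_iff[of "multinacci n" n] multinacci_props[OF assms] by simp

lemma multinacci_unique: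
  assumes "2 \<le> n" "0 < x" "x ^ n = (\<Sum>i<n. x ^ i)"
  shows "x = multinacci n"
proof -
  have "0 < multinacci n" using multinacci_props(2)[OF assms(1)] by simp
  then show ?thesis
    using multinacci_ex1(1)[OF assms(1)] multinacci_props(1)[OF assms(1)] multinacci_equation_iff[of x n] assms(2,3)
    by blast
qed

text \<open>In the coordinate \<open>z = 2x - 1\<close> the symmetric map \<open>T_plus \<beta> (1 - \<beta>/2)\<close> becomes the following odd map
  (odd up to its value at 0).\<close>

definition sym_map :: "real \<Rightarrow> real \<Rightarrow> real" where
  "sym_map \<beta> z = (if z < 0 then \<beta> * z + 1 else \<beta> * z - 1)"

lemma crit_sym: "\<beta> > 0 \<Longrightarrow> crit \<beta> (1 - \<beta> / 2) = 1 / 2"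
  by (simp add: crit_def)

lemma T_plus_sym_map:
  assumes "\<beta> > 0"
  shows "2 * T_plus \<beta> (1 - \<beta> / 2) x - 1 = sym_map \<beta> (2 * x - 1)"
  by (auto simp: T_plus_def sym_map_def crit_sym[OF assms] algebra_simps)

lemma T_plus_sym_map_funpow:
  assumes "\<beta> > 0"
  shows "2 * (T_plus \<beta> (1 - \<beta> / 2) ^^ i) x - 1 = (sym_map \<beta> ^^ i) (2 * x - 1)"
  by (induction i) (auto simp: T_plus_sym_map[OF assms])

lemma sym_map_image:
  assumes "1 < \<beta>" "\<beta> \<le> 2" "\<bar>z\<bar> \<le> 1"
  shows "\<bar>sym_map \<beta> z\<bar> \<le> 1"
proof -
  have "\<beta> * \<bar>z\<bar> \<le> 2 * 1" using assms by (intro mult_mono) auto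
  then have "\<bar>\<beta> * z\<bar> \<le> 2" using assms by (simp add: abs_mult)
  moreover have "z < 0 \<longleftrightarrow> \<beta> * z < 0" using assms by (simp add: mult_less_0_iff)
  ultimately show ?thesis by (auto simp: sym_map_def abs_le_iff)
qed

text \<open>Since \<beta>^2 - \<beta> \<le> 2 - \<beta> < 1, the first step moves a point of the
  window to the other side of 0. The two steps thus use opposite branches, and their constants
  combine to plus or minus \<beta> - 1, the half-width of the window.\<close>

lemma sym_map_renormalise:
  assumes "1 < \<beta>" "\<beta>\<^sup>2 \<le> 2" "\<bar>w\<bar> \<le> 1"
  shows "sym_map \<beta> (sym_map \<beta> ((\<beta> - 1) * w)) = (\<beta> - 1) * sym_map (\<beta>\<^sup>2) w"
proof -
  have "\<beta> * (\<beta> - 1) < 1" using assms by (simp add: power2_eq_square algebra_simps)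
  moreover have "\<beta> * (\<beta> - 1) * \<bar>w\<bar> \<le> \<beta> * (\<beta> - 1) * 1" using assms by (intro mult_left_mono) auto
  moreover have "\<bar>\<beta> * ((\<beta> - 1) * w)\<bar> = \<beta> * (\<beta> - 1) * \<bar>w\<bar>"
    using assms by (simp add: abs_mult)
  ultimately have "\<bar>\<beta> * ((\<beta> - 1) * w)\<bar> < 1" by linarith
  then have "-1 < \<beta> * ((\<beta> - 1) * w)" "\<beta> * ((\<beta> - 1) * w) < 1" by linarith+
  moreover have "(\<beta> - 1) * w < 0 \<longleftrightarrow> w < 0" using assms by (simp add: mult_less_0_iff)
  ultimately show ?thesis
    by (auto simp: sym_map_def power2_eq_square algebra_simps)
qed

text \<open>The first step takes -1 to 1 - \<beta>, the left end of the window, which explains the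
  odd time. From then on two steps count as one step of slope \<beta>^2.\<close>

lemma sym_map_orbit_renormalise:
  assumes "1 < \<beta>" "\<beta>\<^sup>2 \<le> 2"
  shows "(sym_map \<beta> ^^ Suc (2 * j)) (-1) = (\<beta> - 1) * (sym_map (\<beta>\<^sup>2) ^^ j) (-1)"
proof (induction j)
  case 0
  show ?case by (simp add: sym_map_def)
next
  case (Suc j)
  have "1 < \<beta>\<^sup>2" using assms by (simp add: one_less_power)
  then have "\<bar>(sym_map (\<beta>\<^sup>2) ^^ j) (-1)\<bar> \<le> 1"
    by (induction j) (use assms sym_map_image in auto)
  from sym_map_renormalise[OF assms this] show ?case using Suc.IH by simp
qed

lemma sym_map_orbit_multinacci:
  assumes "2 \<le> n"
  shows "(sym_map (multinacci n) ^^ n) (-1) = 0"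
proof -
  let ?g = "multinacci n"
  \<comment> \<open>This is the orbit of -1 under the branch \<open>?g * z + 1\<close> alone; the
    multinacci equation makes it vanish at time \<open>n\<close>.\<close>
  define a where "a i = (\<Sum>l<i. ?g ^ l) - ?g ^ i" for i
  have step: "a (Suc i) = ?g * a i + 1" for i
    unfolding a_def by (subst sum.lessThan_Suc_shift) (simp add: sum_distrib_left algebra_simps)
  have an: "a n = 0" using multinacci_power[OF assms] by (simp add: a_def)
  have neg: "a i < 0" if "i < n" for i
  proof -
    \<comment> \<open>Downward induction from \<open>n\<close>, where the implication is vacuous:
      \<open>a (Suc i) \<le> 0\<close> forces \<open>?g * a i \<le> -1\<close>. Negativity shows
      that the left branch really is the one in use before time \<open>n\<close>.\<close>
    have "i < n \<longrightarrow> a i < 0" if "i \<le> n"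
      using that
    proof (induction rule: inc_induct)
      case (step i)
      have "a (Suc i) \<le> 0" using step an by (cases "Suc i = n") auto
      then have "?g * a i < 0" using \<open>a (Suc i) = ?g * a i + 1\<close> by simp
      then show ?case using multinacci_props(2)[OF assms] by (simp add: mult_less_0_iff)
    qed simp
    then show ?thesis using that by simp
  qed
  have "(sym_map ?g ^^ i) (-1) = a i" if "i \<le> n" for i
    using that
  proof (induction i)
    case (Suc i)
    then show ?case using neg[of i] by (simp add: sym_map_def step)
  qed (simp add: a_def)
  then show ?thesis using an by simp
qed

lemma power2_le_of_power_two_power:
  fixes \<beta> :: real
  assumes "1 < \<beta>" "k \<ge> 1"
  shows "\<beta>\<^sup>2 \<le> \<beta> ^ (2 ^ k)"
proof -
  have "(2::nat) ^ 1 \<le> 2 ^ k" using assms(2) by (intro power_increasing) auto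
  then show ?thesis using assms(1) by (intro power_increasing) auto
qed

text \<open>The point -1 is the image of the critical point 0. Passing from \<beta> to \<beta>^2
  lowers \<open>k\<close> by one.\<close>

lemma sym_map_orbit_root:
  assumes "2 \<le> n" "1 < \<beta>" "\<beta> ^ (2 ^ k) = multinacci n"
  shows "\<exists>j. (sym_map \<beta> ^^ j) (-1) = 0"
  using assms(2,3)
proof (induction k arbitrary: \<beta>)
  case 0
  then show ?case using sym_map_orbit_multinacci[OF assms(1)] by auto
next
  case (Suc k)
  have "1 < \<beta>\<^sup>2" using Suc.prems by (simp add: one_less_power)
  moreover have "(\<beta>\<^sup>2) ^ (2 ^ k) = multinacci n" using Suc.prems by (simp flip: power_mult)
  ultimately obtain j where "(sym_map (\<beta>\<^sup>2) ^^ j) (-1) = 0" using Suc.IH by blast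
  moreover have "\<beta>\<^sup>2 \<le> 2"
    using power2_le_of_power_two_power[of \<beta> "Suc k"] Suc.prems multinacci_props(3)[OF assms(1)] by linarith
  ultimately have "(sym_map \<beta> ^^ Suc (2 * j)) (-1) = 0"
    using sym_map_orbit_renormalise[of \<beta> j] Suc.prems by simp
  then show ?case by blast
qed

lemma subshift_finite_type_sym:
  assumes "1 < \<beta>" "\<beta> \<le> 2" "(sym_map \<beta> ^^ j) (-1) = 0"
  shows "subshift_finite_type (beta_shift \<beta> (1 - \<beta> / 2))"
proof -
  let ?\<alpha> = "1 - \<beta> / 2"
  \<comment> \<open>The map is odd except at 0, so up to the first visit to 0 the orbits of 1 and -1
    are mirror images and reach 0 together.\<close>
  define m where "m = (LEAST j. (sym_map \<beta> ^^ j) (-1) = 0)"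
  have m: "(sym_map \<beta> ^^ m) (-1) = 0" and least: "\<And>i. i < m \<Longrightarrow> (sym_map \<beta> ^^ i) (-1) \<noteq> 0"
    unfolding m_def using assms(3) by (rule LeastI) (rule not_less_Least)
  have "m \<noteq> 0" using m by (intro notI) simp
  then obtain l where l: "m = Suc l" by (cases m) auto
  have odd: "(sym_map \<beta> ^^ i) 1 = - (sym_map \<beta> ^^ i) (-1)" if "i \<le> m" for i
    using that
  proof (induction i)
    case (Suc i)
    moreover have "sym_map \<beta> (- z) = - sym_map \<beta> z" if "z \<noteq> 0" for z
      using that by (auto simp: sym_map_def)
    ultimately show ?case using least[of i] by simp
  qed simp
  have pos: "\<beta> > 0" using assms by simp
  \<comment> \<open>In the coordinate z the branch endpoints \<open>?\<alpha>\<close> and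
    \<open>\<beta> + ?\<alpha> - 1\<close> are the images of -1 and 1, so they need one step
    less.\<close>
  have "(sym_map \<beta> ^^ l) (2 * ?\<alpha> - 1) = 0"
    using m unfolding l funpow_Suc_right by (simp add: sym_map_def algebra_simps)
  then have "(T_plus \<beta> ?\<alpha> ^^ l) ?\<alpha> = 1 / 2"
    using T_plus_sym_map_funpow[OF pos, of l ?\<alpha>] by simp
  moreover have "(sym_map \<beta> ^^ l) (2 * (\<beta> + ?\<alpha> - 1) - 1) = 0"
    using odd[of m] m unfolding l funpow_Suc_right by (simp add: sym_map_def algebra_simps)
  then have "(T_plus \<beta> ?\<alpha> ^^ l) (\<beta> + ?\<alpha> - 1) = 1 / 2"
    using T_plus_sym_map_funpow[OF pos, of l "\<beta> + ?\<alpha> - 1"] by simp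
  ultimately interpret intermediate_markov \<beta> ?\<alpha> "Suc l" l l
    using assms by unfold_locales (auto simp: crit_sym)
  show ?thesis by (rule subshift_finite_type_beta_shift)
qed

section \<open>Transitivity\<close>

lemma not_transitiveI:
  assumes "T ` S \<subseteq> S" "{a<..<b} \<subseteq> S" "0 \<le> a" "a < b" "b \<le> 1" "y \<in> {0<..<1}" "y \<notin> S"
  shows "\<not> transitive_map T"
proof
  assume "transitive_map T"
  then obtain m where "{0<..<1} \<subseteq> (\<Union>i\<in>{1..m}. (T ^^ i) ` {a<..<b})"
    using assms(3-5) unfolding transitive_map_def by blast
  then obtain i x where "x \<in> S" "y = (T ^^ i) x" using assms(2,6) by blast
  moreover have "(T ^^ i) x \<in> S" if "x \<in> S" for x
    using that by (induction i) (use assms(1) in auto)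
  ultimately show False using assms(7) by blast
qed

text \<open>In the coordinate \<open>z = 2x - 1\<close> the sets \<open>\<bar>z\<bar> \<le> \<beta> - 1\<close> and \<open>1 + \<beta> - \<beta>\<^sup>2 \<le> \<bar>z\<bar> \<le> 1\<close> are exchanged;
  they leave a gap exactly if \<open>\<beta>\<^sup>2 < 2\<close>.\<close>

lemma not_transitive_sym:
  assumes "1 < \<beta>" "\<beta>\<^sup>2 < 2"
    and T: "\<And>x. 2 * x - 1 \<le> 0 \<and> 2 * T x - 1 = \<beta> * (2 * x - 1) + 1 \<or>
               2 * x - 1 \<ge> 0 \<and> 2 * T x - 1 = \<beta> * (2 * x - 1) - 1"
  shows "\<not> transitive_map T"
proof (rule not_transitiveI)
  define P where "P z \<longleftrightarrow> z \<le> 1 \<and> (z \<le> \<beta> - 1 \<or> 1 + \<beta> - \<beta>\<^sup>2 \<le> z)" for z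
  let ?S = "{x. P \<bar>2 * x - 1\<bar>}"
  \<comment> \<open>The product is the slack in \<open>key\<close>, which says that the inner end of
    the outer piece is mapped into the window.\<close>
  have "(\<beta> - 1) * (2 - \<beta>\<^sup>2) \<ge> 0" using assms by (intro mult_nonneg_nonneg) auto
  then have key: "1 - \<beta> \<le> \<beta> * (1 + \<beta> - \<beta>\<^sup>2) - 1" by (simp add: algebra_simps power2_eq_square)
  have "\<not> 2 \<le> \<beta>"
  proof
    assume "2 \<le> \<beta>"
    then have "2\<^sup>2 \<le> \<beta>\<^sup>2" by (intro power_mono) auto
    with assms(2) show False by simp
  qed
  have pos: "P \<bar>\<beta> * z - 1\<bar>" if z: "0 \<le> z" "P z" for z
  proof -
    have b: "\<beta> * z \<le> \<beta>" "0 \<le> \<beta> * z" using z assms by (auto simp: P_def)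
    consider "z \<le> \<beta> - 1" | "1 + \<beta> - \<beta>\<^sup>2 \<le> z" using z by (auto simp: P_def)
    then show ?thesis
    proof cases
      case 1
      then have "\<beta> * z \<le> \<beta> * (\<beta> - 1)" using assms by (intro mult_left_mono) auto
      then have "\<beta> * z \<le> \<beta>\<^sup>2 - \<beta>" by (simp add: algebra_simps power2_eq_square)
      then show ?thesis using b \<open>\<not> 2 \<le> \<beta>\<close> by (auto simp: P_def abs_if)
    next
      case 2
      then have "\<beta> * (1 + \<beta> - \<beta>\<^sup>2) \<le> \<beta> * z" using assms by (intro mult_left_mono) auto
      then have "1 - \<beta> \<le> \<beta> * z - 1" using key by linarith
      then show ?thesis using b \<open>\<not> 2 \<le> \<beta>\<close> by (auto simp: P_def abs_if)
    qed
  qed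
  show "T ` ?S \<subseteq> ?S"
  proof safe
    fix x assume x: "P \<bar>2 * x - 1\<bar>"
    \<comment> \<open>By symmetry the modulus of the image depends only on the modulus of z,
      whichever branch is used.\<close>
    have "\<bar>2 * T x - 1\<bar> = \<bar>\<beta> * \<bar>2 * x - 1\<bar> - 1\<bar>"
      using T[of x] by (auto simp: abs_if algebra_simps)
    then show "P \<bar>2 * T x - 1\<bar>" using pos[OF _ x] by simp
  qed
  show "{(2 - \<beta>) / 2<..<\<beta> / 2} \<subseteq> ?S" using \<open>\<not> 2 \<le> \<beta>\<close> by (auto simp: P_def abs_if field_simps)
  show "0 \<le> (2 - \<beta>) / 2" "(2 - \<beta>) / 2 < \<beta> / 2" "\<beta> / 2 \<le> 1" using \<open>\<not> 2 \<le> \<beta>\<close> assms by auto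
  \<comment> \<open>In the coordinate z this is the midpoint of the gap between \<beta> - 1 and 1 +
    \<beta> - \<beta>^2.\<close>
  let ?y = "(1 + (\<beta> - \<beta>\<^sup>2 / 2)) / 2"
  have "(\<beta> - 1)\<^sup>2 \<ge> 0" by simp
  then have "2 * \<beta> - \<beta>\<^sup>2 \<le> 1" by (simp add: power2_eq_square algebra_simps)
  then show "?y \<in> {0<..<1}" "?y \<notin> ?S" using assms by (auto simp: P_def field_simps)
qed

section \<open>Growth of intervals under the greedy map\<close>

text \<open>The critical point is \<open>1 / \<beta>\<close> and is sent to 0. For an interval
  containing it only the right part is followed, whose image contains 0 itself.\<close>

lemma T_plus_crit_image:
  assumes "\<beta> > 1"
  shows "e \<le> 1 / \<beta> \<Longrightarrow> 0 \<le> a \<Longrightarrow> {\<beta> * a..<\<beta> * e} \<subseteq> T_plus \<beta> 0 ` {a..<e}"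
    and "b \<le> 1 / \<beta> \<Longrightarrow> {\<beta> * a<..<\<beta> * b} \<subseteq> T_plus \<beta> 0 ` {a<..<b}"
    and "1 / \<beta> \<le> a \<Longrightarrow> {\<beta> * a - 1<..<\<beta> * b - 1} \<subseteq> T_plus \<beta> 0 ` {a<..<b}"
    and "a < 1 / \<beta> \<Longrightarrow> 1 / \<beta> < b \<Longrightarrow> {0..<\<beta> * b - 1} \<subseteq> T_plus \<beta> 0 ` {a<..<b}"
proof -
  show "{\<beta> * a..<\<beta> * e} \<subseteq> T_plus \<beta> 0 ` {a..<e}" if "e \<le> 1 / \<beta>" "0 \<le> a"
  proof
    fix y assume "y \<in> {\<beta> * a..<\<beta> * e}"
    then show "y \<in> T_plus \<beta> 0 ` {a..<e}"
      using that assms by (intro image_eqI[of _ _ "y / \<beta>"]) (auto simp: T_plus_def crit_def field_simps)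
  qed
  show "{\<beta> * a<..<\<beta> * b} \<subseteq> T_plus \<beta> 0 ` {a<..<b}" if "b \<le> 1 / \<beta>"
  proof
    fix y assume "y \<in> {\<beta> * a<..<\<beta> * b}"
    then show "y \<in> T_plus \<beta> 0 ` {a<..<b}"
      using that assms by (intro image_eqI[of _ _ "y / \<beta>"]) (auto simp: T_plus_def crit_def field_simps)
  qed
  show "{\<beta> * a - 1<..<\<beta> * b - 1} \<subseteq> T_plus \<beta> 0 ` {a<..<b}" if "1 / \<beta> \<le> a"
  proof
    fix y assume y: "y \<in> {\<beta> * a - 1<..<\<beta> * b - 1}"
    have "1 \<le> \<beta> * a" using that assms by (simp add: field_simps)
    then have "0 \<le> y" using y by simp
    then have "\<not> (y + 1) / \<beta> < 1 / \<beta>" using assms by (simp add: divide_right_mono not_less)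
    then have "y = T_plus \<beta> 0 ((y + 1) / \<beta>)" using assms by (simp add: T_plus_def crit_def)
    moreover have "(y + 1) / \<beta> \<in> {a<..<b}" using y assms by (auto simp: field_simps)
    ultimately show "y \<in> T_plus \<beta> 0 ` {a<..<b}" by (rule image_eqI)
  qed
  show "{0..<\<beta> * b - 1} \<subseteq> T_plus \<beta> 0 ` {a<..<b}" if "a < 1 / \<beta>" "1 / \<beta> < b"
  proof
    fix y assume y: "y \<in> {0..<\<beta> * b - 1}"
    then have "\<not> (y + 1) / \<beta> < 1 / \<beta>" using assms by (simp add: divide_right_mono not_less)
    then have "y = T_plus \<beta> 0 ((y + 1) / \<beta>)" using assms by (simp add: T_plus_def crit_def)
    moreover have "a < (y + 1) / \<beta>" using \<open>\<not> (y + 1) / \<beta> < 1 / \<beta>\<close> that by linarith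
    moreover have "(y + 1) / \<beta> < b" using y assms by (simp add: field_simps)
    ultimately show "y \<in> T_plus \<beta> 0 ` {a<..<b}" by (intro image_eqI) auto
  qed
qed

lemma funpow_Suc_image_mono: "J' \<subseteq> T ` J \<Longrightarrow> (T ^^ i) ` J' \<subseteq> (T ^^ Suc i) ` J"
  unfolding funpow_Suc_right image_comp[symmetric] by (rule image_mono)

text \<open>An interval without the critical point in its interior is stretched by \<beta> and stays
  in [0,1], so this cannot go on for \<open>j\<close> steps. Once it contains the critical point,
  its image includes a right neighbourhood of 0.\<close>

lemma greedy_reaches_zero:
  assumes "1 < \<beta>" "\<beta> \<le> 2" "0 \<le> a" "b \<le> 1" "1 < \<beta> ^ j * (b - a)"
  shows "\<exists>i\<ge>1. \<exists>\<epsilon>>0. {0..<\<epsilon>} \<subseteq> (greedy_map \<beta> ^^ i) ` {a<..<b}"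
  using assms(3-)
proof (induction j arbitrary: a b)
  case 0
  then show ?case by simp
next
  case (Suc j)
  note im = T_plus_crit_image[OF assms(1), folded greedy_map_def]
  have lift: ?case if "{a'<..<b'} \<subseteq> greedy_map \<beta> ` {a<..<b}" "0 \<le> a'" "b' \<le> 1" "b' - a' = \<beta> * (b - a)" for a' b'
  proof -
    have "1 < \<beta> ^ j * (b' - a')" using Suc.prems(3) that(4) by (simp add: ac_simps)
    from Suc.IH[OF that(2,3) this] obtain i \<epsilon> where
      i: "\<epsilon> > 0" "{0..<\<epsilon>} \<subseteq> (greedy_map \<beta> ^^ i) ` {a'<..<b'}" by (elim exE conjE)
    have "{0..<\<epsilon>} \<subseteq> (greedy_map \<beta> ^^ Suc i) ` {a<..<b}"
      using i(2) funpow_Suc_image_mono[OF that(1), of i] by (rule order.trans)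
    with i(1) show ?thesis by (intro exI[of _ "Suc i"] exI[of _ \<epsilon>] conjI) (assumption | simp)+
  qed
  consider "b \<le> 1 / \<beta>" | "1 / \<beta> \<le> a" | "a < 1 / \<beta>" "1 / \<beta> < b" by linarith
  then show ?case
  proof cases
    case 1
    have "\<beta> * b \<le> 1" using 1 assms(1) by (simp add: field_simps)
    then show ?thesis using Suc.prems assms(1)
      by (intro lift[OF im(2)[OF 1]]) (auto simp: algebra_simps)
  next
    case 2
    have "1 \<le> \<beta> * a" using 2 assms(1) by (simp add: field_simps)
    moreover have "0 \<le> b"
    proof (rule ccontr)
      assume "\<not> 0 \<le> b"
      then have "\<beta> ^ Suc j * (b - a) \<le> 0" using Suc.prems(1) assms(1) by (intro mult_nonneg_nonpos) auto
      with Suc.prems(3) show False by simp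
    qed
    then have "\<beta> * b \<le> 2 * 1" using assms(1,2) Suc.prems(2) by (intro mult_mono) auto
    ultimately show ?thesis using Suc.prems assms(1)
      by (intro lift[OF im(3)[OF 2]]) (auto simp: algebra_simps)
  next
    case 3
    then have "\<beta> * b - 1 > 0" using assms(1) by (simp add: field_simps)
    with im(4)[OF 3] show ?thesis by (intro exI[of _ "1::nat"] exI[of _ "\<beta> * b - 1"] conjI) simp_all
  qed
qed

text \<open>The left branch fixes 0 and stretches \<open>{0..<\<epsilon>}\<close> until it covers
  that branch's whole domain, which is mapped onto [0,1).\<close>

lemma greedy_fills:
  assumes "1 < \<beta>" "0 < \<epsilon>" "1 < \<beta> ^ j * \<epsilon>"
  shows "\<exists>i. {0..<1} \<subseteq> (greedy_map \<beta> ^^ i) ` {0..<\<epsilon>}"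
  using assms(2-)
proof (induction j arbitrary: \<epsilon>)
  case 0
  then show ?case by (intro exI[of _ 0]) auto
next
  case (Suc j)
  note im = T_plus_crit_image(1)[OF assms(1), of _ 0, folded greedy_map_def]
  show ?case
  proof (cases "\<epsilon> \<le> 1 / \<beta>")
    case True
    have "0 < \<beta> * \<epsilon>" "1 < \<beta> ^ j * (\<beta> * \<epsilon>)" using Suc.prems assms(1) by (auto simp: ac_simps)
    then obtain i where "{0..<1} \<subseteq> (greedy_map \<beta> ^^ i) ` {0..<\<beta> * \<epsilon>}" using Suc.IH by blast
    moreover have "{0..<\<beta> * \<epsilon>} \<subseteq> greedy_map \<beta> ` {0..<\<epsilon>}" using im[OF True] by simp
    ultimately show ?thesis using funpow_Suc_image_mono[of "{0..<\<beta> * \<epsilon>}" "greedy_map \<beta>" "{0..<\<epsilon>}" i]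
      by (intro exI[of _ "Suc i"]) (rule order.trans)
  next
    case False
    have "{0..<\<beta> * (1 / \<beta>)} \<subseteq> greedy_map \<beta> ` {0..<1 / \<beta>}" using im[of "1 / \<beta>"] by simp
    then have "{0..<1} \<subseteq> greedy_map \<beta> ` {0..<1 / \<beta>}" using assms(1) by simp
    also have "\<dots> \<subseteq> greedy_map \<beta> ` {0..<\<epsilon>}" using False by (intro image_mono) auto
    finally show ?thesis by (intro exI[of _ 1]) simp
  qed
qed

lemma transitive_greedy_map:
  assumes "1 < \<beta>" "\<beta> \<le> 2"
  shows "transitive_map (greedy_map \<beta>)"
  unfolding transitive_map_def
proof (intro allI impI, elim conjE)
  fix a b :: real assume ab: "0 \<le> a" "a < b" "b \<le> 1"
  have large: "\<exists>j. 1 < \<beta> ^ j * c" if "c > 0" for c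
  proof -
    obtain j where "1 / c < \<beta> ^ j" using real_arch_pow[OF assms(1)] by blast
    then show ?thesis using that by (auto simp: field_simps)
  qed
  from large[of "b - a"] ab obtain j where "1 < \<beta> ^ j * (b - a)" by auto
  from greedy_reaches_zero[OF assms ab(1,3) this] obtain i \<epsilon> where i: "i \<ge> 1" "\<epsilon> > 0" "{0..<\<epsilon>} \<subseteq> (greedy_map \<beta> ^^ i) ` {a<..<b}"
    by (elim exE conjE)
  from large[OF i(2)] obtain l where l: "{0..<1} \<subseteq> (greedy_map \<beta> ^^ l) ` {0..<\<epsilon>}"
    using greedy_fills[OF assms(1) i(2)] by blast
  have "{0<..<1} \<subseteq> {0..<1::real}" by auto
  also note l
  also have "(greedy_map \<beta> ^^ l) ` {0..<\<epsilon>} \<subseteq> (greedy_map \<beta> ^^ (l + i)) ` {a<..<b}"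
    using image_mono[OF i(3), of "greedy_map \<beta> ^^ l"] by (simp add: funpow_add image_comp)
  also have "\<dots> \<subseteq> (\<Union>i\<in>{1..l + i}. (greedy_map \<beta> ^^ i) ` {a<..<b})"
    using i(1) by (intro UN_upper) auto
  finally show "\<exists>m. {0<..<1} \<subseteq> (\<Union>i\<in>{1..m}. (greedy_map \<beta> ^^ i) ` {a<..<b})" by blast
qed

lemma transitive_map_reflect:
  fixes S T :: "real \<Rightarrow> real"
  assumes "transitive_map T" "\<And>x. S (1 - x) = 1 - T x"
  shows "transitive_map S"
  unfolding transitive_map_def
proof (intro allI impI, elim conjE)
  fix a b :: real assume ab: "0 \<le> a" "a < b" "b \<le> 1"
  then have "0 \<le> 1 - b \<and> 1 - b < 1 - a \<and> 1 - a \<le> 1" by simp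
  then obtain m where m: "{0<..<1} \<subseteq> (\<Union>i\<in>{1..m}. (T ^^ i) ` {1 - b<..<1 - a})"
    using assms(1) unfolding transitive_map_def by blast
  have "{0<..<1} \<subseteq> (\<Union>i\<in>{1..m}. (S ^^ i) ` {a<..<b})"
  proof
    fix y :: real assume "y \<in> {0<..<1}"
    then have "1 - y \<in> {0<..<1}" by simp
    with m obtain i x where "i \<in> {1..m}" "x \<in> {1 - b<..<1 - a}" "1 - y = (T ^^ i) x" by blast
    moreover from this have "y = (S ^^ i) (1 - x)" using funpow_reflect[of S T i x, OF assms(2)] by simp
    ultimately show "y \<in> (\<Union>i\<in>{1..m}. (S ^^ i) ` {a<..<b})"
      by (intro UN_I[of i] image_eqI[of _ _ "1 - x"]) auto
  qed
  then show "\<exists>m. {0<..<1} \<subseteq> (\<Union>i\<in>{1..m}. (S ^^ i) ` {a<..<b})" by blast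
qed

lemma transitive_lazy_map:
  assumes "1 < \<beta>" "\<beta> \<le> 2"
  shows "transitive_map (lazy_map \<beta>)"
proof (rule transitive_map_reflect[OF transitive_greedy_map[OF assms]])
  show "lazy_map \<beta> (1 - x) = 1 - greedy_map \<beta> x" for x
    using T_minus_reflect(1)[of \<beta> 0 x] assms by (simp add: lazy_map_def greedy_map_def)
qed

section \<open>Irreducibility of \<open>F(x\<^sup>2)\<close>\<close>

abbreviation ipoly :: "int poly \<Rightarrow> 'a :: comm_ring_1 \<Rightarrow> 'a" where
  "ipoly p \<equiv> poly (map_poly of_int p)"

lemma map_poly_of_int_hom:
  fixes p q :: "int poly"
  shows "map_poly (of_int :: int \<Rightarrow> 'a :: comm_ring_1) (p * q) = map_poly of_int p * map_poly of_int q"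
    and "map_poly (of_int :: int \<Rightarrow> 'a) (p + q) = map_poly of_int p + map_poly of_int q"
    and "map_poly (of_int :: int \<Rightarrow> 'a) (p - q) = map_poly of_int p - map_poly of_int q"
    and "map_poly (of_int :: int \<Rightarrow> 'a) (smult a p) = smult (of_int a) (map_poly of_int p)"
  by (auto simp: poly_eq_iff coeff_map_poly coeff_mult)

lemma map_poly_of_int_pCons:
  "map_poly (of_int :: int \<Rightarrow> 'a :: comm_ring_1) (pCons a p) = pCons (of_int a) (map_poly of_int p)"
  by (cases "a = 0 \<and> p = 0") (auto simp: map_poly_pCons)

lemma ipoly_pcompose: "ipoly (pcompose p q) z = ipoly p (ipoly q z)"
  by (induction p) (auto simp: pcompose_pCons map_poly_of_int_hom map_poly_of_int_pCons)

lemma ipoly_of_real: "ipoly p (of_real x :: complex) = of_real (ipoly p x)"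
  by (induction p) (auto simp: map_poly_of_int_pCons)

lemma degree_of_int_poly [simp]: "degree (map_poly (of_int :: int \<Rightarrow> complex) p) = degree p"
  by (rule degree_map_poly) auto

lemma ipoly_const_nonzero:
  fixes z :: complex
  assumes "p \<noteq> 0" "ipoly p z = 0"
  shows "degree p > 0"
proof (rule ccontr)
  assume "\<not> degree p > 0"
  then obtain a where "p = [:a:]" by (auto elim: degree_eq_zeroE)
  with assms show False by (auto simp: map_poly_of_int_pCons)
qed

text \<open>The proof is division by a polynomial of least degree vanishing at \<open>\<theta>\<close>.\<close>

lemma irreducible_dvd_of_common_root:
  fixes F P :: "int poly" and \<theta> :: complex
  assumes F: "irreducible F" "ipoly F \<theta> = 0" and P: "ipoly P \<theta> = 0"
  shows "F dvd P"
proof -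
  have prime: "prime_elem F" using F(1) by (rule irreducible_imp_prime_elem)
  have "F \<noteq> 0" using F(1) by auto
  define Q where "Q q \<longleftrightarrow> q \<noteq> 0 \<and> ipoly q \<theta> = 0" for q :: "int poly"
  have "Q F" using F \<open>F \<noteq> 0\<close> by (simp add: Q_def)
  define q where "q = arg_min degree Q"
  have q: "Q q" and least: "\<And>r. Q r \<Longrightarrow> degree q \<le> degree r"
    unfolding q_def using arg_min_natI[of Q F degree] arg_min_nat_le[of Q _ degree] \<open>Q F\<close> by auto
  have q0: "q \<noteq> 0" and deg: "degree q > 0" using q ipoly_const_nonzero[of q \<theta>] by (auto simp: Q_def)
  have degF: "degree F > 0" using ipoly_const_nonzero[OF \<open>F \<noteq> 0\<close> F(2)] .
  \<comment> \<open>As \<open>q\<close> need not be monic, division over the integers costs a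
    nonzero constant factor. The remainder vanishes at \<theta> and is zero by minimality.\<close>
  have dvd: "\<exists>a. a \<noteq> 0 \<and> q dvd smult a P" if "ipoly P \<theta> = 0" for P
  proof -
    obtain a s where a: "a \<noteq> 0" "smult a P = q * s + pseudo_mod P q" and
      small: "pseudo_mod P q = 0 \<or> degree (pseudo_mod P q) < degree q"
      using pseudo_mod[OF q0, of P] by blast
    have "ipoly (smult a P) \<theta> = ipoly (q * s + pseudo_mod P q) \<theta>" using a by simp
    then have "ipoly (pseudo_mod P q) \<theta> = 0" using that q by (simp add: map_poly_of_int_hom Q_def)
    then have "pseudo_mod P q = 0" using small least[of "pseudo_mod P q"] unfolding Q_def by (metis leD)
    then show ?thesis using a by auto
  qed
  obtain a s where a: "a \<noteq> 0" "smult a F = q * s" using dvd[OF F(2)] unfolding dvd_def by blast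
  have "F dvd q * s" unfolding a(2)[symmetric] by (simp add: dvd_smult)
  moreover have "\<not> F dvd s"
  proof
    assume "F dvd s"
    then obtain t where "s = F * t" by (elim dvdE)
    then have "F * [:a:] = F * (q * t)" using a(2) by (simp add: ac_simps)
    then have eq: "[:a:] = q * t" using \<open>F \<noteq> 0\<close> by (metis mult_cancel_left)
    then have "t \<noteq> 0" using a(1) by auto
    then have "degree (q * t) > 0" using q0 deg by (simp add: degree_mult_eq)
    then show False using eq by (metis degree_pCons_0 less_irrefl)
  qed
  ultimately have "F dvd q" using prime prime_elem_dvd_multD by blast
  obtain b where b: "b \<noteq> 0" "q dvd smult b P" using dvd[OF P] by blast
  have "F dvd [:b:] * P" using \<open>F dvd q\<close> b(2) dvd_trans by fastforce
  moreover have "\<not> F dvd [:b:]"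
    using degF b(1) dvd_imp_degree_le[of F "[:b:]"] by auto
  ultimately show "F dvd P" using prime prime_elem_dvd_multD by blast
qed

definition even_subst :: "int poly \<Rightarrow> int poly" where
  "even_subst p = pcompose p [:0, 0, 1:]"

definition neg_subst :: "int poly \<Rightarrow> int poly" where
  "neg_subst p = pcompose p [:0, -1:]"

lemma even_subst_simps:
  "even_subst (p * q) = even_subst p * even_subst q"
  "even_subst (p + q) = even_subst p + even_subst q"
  "even_subst (p - q) = even_subst p - even_subst q"
  "even_subst (pCons a p) = [:a:] + [:0, 0, 1:] * even_subst p"
  "even_subst 0 = 0" "even_subst [:a:] = [:a:]" "even_subst (- p) = - even_subst p"
  "even_subst 1 = 1"
  by (simp_all add: even_subst_def pcompose_mult pcompose_add pcompose_diff pcompose_pCons pcompose_uminus pcompose_1)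

lemma neg_subst_simps:
  "neg_subst (p * q) = neg_subst p * neg_subst q"
  "neg_subst (p + q) = neg_subst p + neg_subst q"
  "neg_subst (p - q) = neg_subst p - neg_subst q"
  "neg_subst (pCons a p) = [:a:] - [:0, 1:] * neg_subst p"
  "neg_subst 0 = 0" "neg_subst [:a:] = [:a:]"
  by (simp_all add: neg_subst_def pcompose_mult pcompose_add pcompose_diff pcompose_pCons)

lemma neg_subst_even_subst: "neg_subst (even_subst p) = even_subst p"
  by (simp add: neg_subst_def even_subst_def pcompose_assoc[symmetric] pcompose_pCons)

lemma ipoly_even_subst: "ipoly (even_subst p) z = ipoly p (z\<^sup>2)"
  by (simp add: even_subst_def ipoly_pcompose map_poly_of_int_pCons power2_eq_square)

lemma coeff_even_subst: "coeff (even_subst p) i = (if even i then coeff p (i div 2) else 0)"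
proof (induction p arbitrary: i)
  case 0
  then show ?case by (simp add: even_subst_simps)
next
  case (pCons a p)
  have e: "[:0, 0, 1:] * even_subst p = pCons 0 (pCons 0 (even_subst p))" by simp
  show ?case
  proof (cases i)
    case (Suc j)
    then show ?thesis
      by (cases j) (auto simp: even_subst_simps(4) e pCons.IH coeff_pCons split: nat.splits)
  qed (simp add: even_subst_simps(4) e)
qed

lemma coeff_neg_subst: "coeff (neg_subst p) i = (-1) ^ i * coeff p i"
proof (induction p arbitrary: i)
  case 0
  then show ?case by (simp add: neg_subst_simps)
next
  case (pCons a p)
  have "[:0, 1:] * neg_subst p = pCons 0 (neg_subst p)" by simp
  then show ?case
    by (cases i) (auto simp: neg_subst_simps(4) pCons.IH)
qed

lemma degree_even_subst: "degree (even_subst p) = 2 * degree p"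
  by (simp add: even_subst_def degree_pcompose)

lemma degree_neg_subst: "degree (neg_subst p) = degree p"
  by (simp add: neg_subst_def degree_pcompose)

lemma lead_coeff_even_subst: "lead_coeff (even_subst p) = lead_coeff p"
  by (simp add: degree_even_subst coeff_even_subst)

lemma lead_coeff_neg_subst: "lead_coeff (neg_subst p) = (-1) ^ degree p * lead_coeff p"
  by (simp add: degree_neg_subst coeff_neg_subst)

lemma even_odd_decomposition: "\<exists>A B. p = even_subst A + [:0, 1:] * even_subst B"
proof (induction p)
  case 0
  show ?case by (intro exI[of _ 0]) (simp add: even_subst_simps)
next
  case (pCons a p)
  then obtain A B where "p = even_subst A + [:0, 1:] * even_subst B" by blast
  then have "pCons a p = even_subst (pCons a B) + [:0, 1:] * even_subst A"
    by (simp add: even_subst_simps(4))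
  then show ?case by blast
qed

text \<open>With m = A(x^2) + x B(x^2) the product is the difference of squares A(x^2)^2 - x^2
  B(x^2)^2.\<close>

lemma mult_neg_subst_even: "\<exists>r. m * neg_subst m = even_subst r"
proof -
  obtain A B where m: "m = even_subst A + [:0, 1:] * even_subst B" using even_odd_decomposition by blast
  have n: "neg_subst m = even_subst A - [:0, 1:] * even_subst B"
    unfolding m neg_subst_simps(1,2) neg_subst_even_subst by (simp add: neg_subst_simps)
  have "m * neg_subst m = even_subst A * even_subst A - [:0, 0, 1:] * (even_subst B * even_subst B)"
    unfolding n by (subst m) (simp add: algebra_simps)
  also have "\<dots> = even_subst (A * A - pCons 0 (B * B))"
    by (simp add: even_subst_simps)
  finally show ?thesis by blast
qed

lemma complex_root_exists:
  assumes "degree (p :: int poly) > 0"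
  shows "\<exists>z::complex. ipoly p z = 0"
  using assms by (intro alg_closed_imp_poly_has_root) simp

text \<open>The leading coefficients are integers with product 1, so a constant factor would be a
  unit.\<close>

lemma monic_factor:
  fixes p q :: "int poly"
  assumes "lead_coeff (p * q) = 1" "\<not> p dvd 1"
  shows "\<bar>lead_coeff p\<bar> = 1" "degree p > 0"
proof -
  have "lead_coeff p * lead_coeff q = 1" using assms(1) by (simp add: lead_coeff_mult)
  then have "\<bar>lead_coeff p * lead_coeff q\<bar> = 1" by simp
  then show l: "\<bar>lead_coeff p\<bar> = 1" by (rule abs_zmult_eq_1)
  show "degree p > 0"
  proof (rule ccontr)
    assume "\<not> degree p > 0"
    then obtain a where a: "p = [:a:]" by (auto elim: degree_eq_zeroE)
    with l have "a dvd 1" by simp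
    then show False using assms(2) a by (simp add: is_unit_const_poly_iff)
  qed
qed

text \<open>If \<open>m\<close> is a proper factor of \<open>F(x\<^sup>2)\<close>, then \<open>m(x) m(-x) = r(x\<^sup>2)\<close> and \<open>F\<close> divides \<open>r\<close>.
  The degrees of both cofactors leave no room for a nonconstant quotient.\<close>

lemma reducible_even_subst:
  assumes F: "irreducible F" "lead_coeff F = 1" and "degree F > 0"
    and red: "\<not> irreducible (even_subst F)"
  shows "\<exists>m e. (e = 1 \<or> e = -1) \<and> m * neg_subst m = e * even_subst F"
proof -
  have lc: "lead_coeff (even_subst F) = 1" using F(2) lead_coeff_even_subst by simp
  have "degree (even_subst F) > 0" using assms(3) by (simp add: degree_even_subst)
  then have "even_subst F \<noteq> 0" "\<not> even_subst F dvd 1"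
    by (auto dest: dvd_imp_degree_le)
  with red obtain m q where mq: "even_subst F = m * q" "\<not> m dvd 1" "\<not> q dvd 1"
    unfolding irreducible_def by blast
  have factor: "\<exists>r. m * neg_subst m = even_subst r \<and> F dvd r \<and> degree r = degree m \<and> r \<noteq> 0"
    if m: "m dvd even_subst F" "degree m > 0" for m
  proof -
    obtain r where r: "m * neg_subst m = even_subst r" using mult_neg_subst_even by blast
    obtain z :: complex where z: "ipoly m z = 0" using complex_root_exists[OF m(2)] by blast
    have "ipoly (even_subst F) z = 0" using m(1) z by (auto elim!: dvdE simp: map_poly_of_int_hom)
    moreover have "ipoly (even_subst r) z = 0" unfolding r[symmetric] using z by (simp add: map_poly_of_int_hom)
    ultimately have "F dvd r" using irreducible_dvd_of_common_root[OF F(1)] by (simp add: ipoly_even_subst)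
    have m0: "m \<noteq> 0" using m(2) by auto
    then have n0: "neg_subst m \<noteq> 0" using degree_neg_subst[of m] m(2) by auto
    have "degree (even_subst r) = degree m + degree m"
      unfolding r[symmetric] using m0 n0 by (simp add: degree_mult_eq degree_neg_subst)
    then have "degree r = degree m" by (simp add: degree_even_subst)
    with r \<open>F dvd r\<close> m(2) show ?thesis by auto
  qed
  have m: "\<bar>lead_coeff m\<bar> = 1" "degree m > 0" using monic_factor[of m q] lc mq by auto
  have q: "degree q > 0" using monic_factor[of q m] lc mq by (auto simp: mult.commute)
  obtain r where r: "m * neg_subst m = even_subst r" "F dvd r" "degree r = degree m" "r \<noteq> 0"
    using factor[of m] mq(1) m by auto
  obtain r' where r': "F dvd r'" "degree r' = degree q" "r' \<noteq> 0"
    using factor[of q] mq(1) q by auto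
  have "degree m + degree q = 2 * degree F"
    unfolding degree_even_subst[symmetric] mq(1) using m(2) q by (subst degree_mult_eq) auto
  moreover have "degree F \<le> degree m" using dvd_imp_degree_le[OF r(2,4)] r(3) by simp
  moreover have "degree F \<le> degree q" using dvd_imp_degree_le[OF r'(1,3)] r'(2) by simp
  ultimately have deg: "degree r = degree F" using r(3) by simp
  obtain t where t: "r = F * t" using r(2) by (elim dvdE)
  have "F \<noteq> 0" "t \<noteq> 0" using t r(4) by auto
  then have "degree t = 0" using deg t by (simp add: degree_mult_eq)
  then obtain c where c: "t = [:c:]" by (auto elim: degree_eq_zeroE)
  have "\<bar>lead_coeff (even_subst r)\<bar> = 1"
    unfolding r(1)[symmetric] lead_coeff_mult lead_coeff_neg_subst using m(1) by (simp add: abs_mult)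
  moreover have "lead_coeff r = lead_coeff F * c" unfolding t lead_coeff_mult c by simp
  ultimately have "\<bar>lead_coeff F * c\<bar> = 1" unfolding lead_coeff_even_subst by simp
  then have "\<bar>c\<bar> = 1" using F(2) by simp
  then have "t = 1 \<or> t = -1" using c by (auto simp: abs_if one_pCons split: if_splits)
  moreover have "m * neg_subst m = even_subst t * even_subst F"
    using r(1) t by (simp add: even_subst_simps mult.commute)
  ultimately show ?thesis by (metis even_subst_simps(7,8))
qed

text \<open>This is the Frobenius identity: modulo 2 squaring is additive and fixes the
  coefficients.\<close>

lemma even_subst_cong_square: "2 dvd even_subst p - p * p"
proof (induction p)
  case (pCons a p)
  then obtain s where s: "even_subst p - p * p = 2 * s" by (elim dvdE)
  have "2 dvd a - a * a" by simp
  then obtain b where b: "a - a * a = 2 * b" by (elim dvdE)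
  define A X where "A = [:a:]" and "X = [:0, 1::int:]"
  have x: "pCons a p = A + X * p" by (simp add: A_def X_def)
  have e: "even_subst (pCons a p) = A + X * X * even_subst p"
    by (simp add: A_def X_def even_subst_simps(4))
  have b': "A - A * A = 2 * [:b:]" using b by (simp add: A_def numeral_poly)
  have "even_subst (pCons a p) - pCons a p * pCons a p =
      (A - A * A) + X * X * (even_subst p - p * p) - 2 * (A * X * p)"
    unfolding e unfolding x by (simp add: algebra_simps)
  also have "\<dots> = 2 * ([:b:] + X * X * s - A * X * p)"
    unfolding s b' by (simp add: algebra_simps)
  finally show ?case by (metis dvd_triv_left)
qed (simp add: even_subst_simps)

lemma neg_subst_cong: "2 dvd neg_subst p - p"
proof (induction p)
  case (pCons a p)
  then obtain s where s: "neg_subst p - p = 2 * s" by (elim dvdE)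
  define X where "X = [:0, 1::int:]"
  have x: "pCons a p = [:a:] + X * p" "neg_subst (pCons a p) = [:a:] - X * neg_subst p"
    by (simp_all add: X_def neg_subst_simps(4))
  have "neg_subst (pCons a p) - pCons a p = - X * (neg_subst p - p) - 2 * (X * p)"
    unfolding x(2) unfolding x(1) by (simp add: algebra_simps)
  also have "\<dots> = 2 * (- X * s - X * p)"
    unfolding s by (simp add: algebra_simps)
  finally show ?case by (metis dvd_triv_left)
qed (simp add: neg_subst_simps)

text \<open>Modulo 2 the hypothesis reads m^2 = F^2, so m = F + 2t. In m(x) m(-x) the cross terms
  2t(x) F(-x) and 2F(x) t(-x) agree modulo 4 and add up to a multiple of 4, so \<open>m\<close> may
  be replaced by \<open>F\<close>.\<close>

lemma mult_neg_subst_cong4: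
  assumes e: "e = 1 \<or> e = -1" and m: "m * neg_subst m = e * even_subst F"
  shows "4 dvd F * neg_subst F - e * even_subst F"
proof -
  have "prime_elem (2 :: int)" by simp
  then have prime: "prime_elem (2 :: int poly)" by (simp add: numeral_poly prime_elem_const_poly_iff)
  obtain s where s: "even_subst F = F * F + 2 * s"
    using even_subst_cong_square[of F] by (auto elim!: dvdE simp: algebra_simps)
  obtain u where u: "neg_subst m = m + 2 * u"
    using neg_subst_cong[of m] by (auto elim!: dvdE simp: algebra_simps)
  obtain e' where e': "e = 1 + 2 * e'"
  proof (cases "e = 1")
    case True
    then show ?thesis using that[of 0] by simp
  next
    case False
    then show ?thesis using e that[of "-1"] by simp
  qed
  have "(m - F) * (m + F) = 2 * (s + e' * (F * F + 2 * s) - m * u)"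
    using m unfolding s u e' by (simp add: algebra_simps)
  then have "2 dvd (m - F) * (m + F)" by simp
  then have "2 dvd m - F \<or> 2 dvd m + F" using prime prime_elem_dvd_multD by blast
  moreover have "m + F = (m - F) + 2 * F" by simp
  ultimately have "2 dvd m - F" by (metis dvd_add_left_iff dvd_triv_left)
  then obtain t where t: "m = F + 2 * t" by (auto elim!: dvdE simp: algebra_simps)
  obtain g where g: "neg_subst F = F + 2 * g"
    using neg_subst_cong[of F] by (auto elim!: dvdE simp: algebra_simps)
  obtain h where h: "neg_subst t = t + 2 * h"
    using neg_subst_cong[of t] by (auto elim!: dvdE simp: algebra_simps)
  have "neg_subst 2 = 2" by (simp add: numeral_poly neg_subst_simps)
  then have nm: "neg_subst m = F + 2 * g + 2 * (t + 2 * h)"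
    unfolding t neg_subst_simps g h by simp
  have "F * neg_subst F - m * neg_subst m = 4 * (- (F * t) - F * h - t * g - t * t - 2 * (t * h))"
    unfolding nm g by (subst t) (simp add: algebra_simps)
  then show ?thesis unfolding m by (metis dvd_triv_left)
qed

section \<open>Conjugates of roots of multinacci numbers\<close>

definition multinacci_poly :: "nat \<Rightarrow> int poly" where
  "multinacci_poly n = monom 1 n - (\<Sum>i<n. monom 1 i)"

lemma coeff_multinacci_poly: "coeff (multinacci_poly n) i = (if i = n then 1 else if i < n then -1 else 0)"
proof -
  have "(\<Sum>j<n. coeff (monom (1::int) j) i) = (if i < n then 1 else 0)"
    by (simp add: coeff_monom sum.delta)
  then show ?thesis unfolding multinacci_poly_def by (simp add: coeff_sum)
qed

lemma degree_multinacci_poly: "degree (multinacci_poly n) = n"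
  by (rule antisym) (auto intro: degree_le le_degree simp: coeff_multinacci_poly)

lemma lead_coeff_multinacci_poly: "lead_coeff (multinacci_poly n) = 1"
  by (simp add: degree_multinacci_poly coeff_multinacci_poly)

lemma map_poly_multinacci_poly:
  "map_poly (of_int :: int \<Rightarrow> 'a :: comm_ring_1) (multinacci_poly n) = monom 1 n - (\<Sum>i<n. monom 1 i)"
proof -
  have "(\<Sum>j<n. coeff (monom (1::'a) j) i) = (if i < n then 1 else 0)" for i
    by (simp add: coeff_monom sum.delta)
  then show ?thesis
    by (simp add: poly_eq_iff coeff_map_poly coeff_multinacci_poly coeff_sum)
qed

lemma ipoly_multinacci_poly: "ipoly (multinacci_poly n) z = z ^ n - (\<Sum>i<n. z ^ i)"
  by (simp add: map_poly_multinacci_poly poly_monom poly_sum)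

text \<open>For a root \<open>z\<close> with \<open>r = \<bar>z\<bar> \<ge> 1\<close>, multiplying by \<open>z - 1\<close> gives \<open>z\<^sup>n (2 - z) = 1\<close>, whereas the triangle
  inequality gives \<open>r\<^sup>n (2 - r) \<ge> 1\<close>. Hence \<open>\<bar>2 - z\<bar> \<le> 2 - \<bar>z\<bar>\<close>, which forces \<open>z = r\<close>.\<close>

lemma multinacci_poly_root:
  fixes z :: complex
  assumes n: "2 \<le> n" and root: "ipoly (multinacci_poly n) z = 0" and "norm z \<ge> 1"
  shows "z = of_real (multinacci n)"
proof -
  define r where "r = norm z"
  have "r \<ge> 1" using assms(3) by (simp add: r_def)
  have geo: "z ^ n = (\<Sum>i<n. z ^ i)" using root by (simp add: ipoly_multinacci_poly)
  have "(z - 1) * z ^ n = z ^ n - 1" using power_diff_1_eq[of z n] unfolding geo[symmetric] by simp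
  then have "z ^ n * (2 - z) = 1" by (simp add: algebra_simps)
  then have "norm (z ^ n * (2 - z)) = 1" by simp
  then have eq: "r ^ n * norm (2 - z) = 1" by (simp add: norm_mult norm_power r_def)
  have "r ^ n \<le> (\<Sum>i<n. norm (z ^ i))"
    unfolding r_def norm_power[symmetric] geo by (rule norm_sum)
  then have "r ^ n \<le> (\<Sum>i<n. r ^ i)" by (simp add: norm_power r_def)
  then have "(r - 1) * r ^ n \<le> (r - 1) * (\<Sum>i<n. r ^ i)" using \<open>r \<ge> 1\<close> by (intro mult_left_mono) auto
  then have "r ^ n * norm (2 - z) \<le> r ^ n * (2 - r)"
    unfolding eq power_diff_1_eq[symmetric] by (simp add: algebra_simps)
  then have le: "norm (2 - z) \<le> 2 - r" using \<open>r \<ge> 1\<close> by simp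
  then have "(norm (2 - z))\<^sup>2 \<le> (2 - r)\<^sup>2" by (intro power_mono) auto
  moreover have "r\<^sup>2 = (Re z)\<^sup>2 + (Im z)\<^sup>2" by (simp add: r_def cmod_power2)
  moreover have "(norm (2 - z))\<^sup>2 = (2 - Re z)\<^sup>2 + (Im z)\<^sup>2" by (simp add: cmod_power2)
  ultimately have "r \<le> Re z" by (simp add: power2_eq_square algebra_simps)
  moreover have "Re z \<le> r" unfolding r_def by (rule complex_Re_le_cmod)
  ultimately have "Re z = r" by simp
  moreover from this have "Im z = 0" using \<open>r\<^sup>2 = (Re z)\<^sup>2 + (Im z)\<^sup>2\<close> by simp
  ultimately have z: "z = of_real r" by (simp add: complex_eq_iff)
  have "of_real (r ^ n) = (of_real (\<Sum>i<n. r ^ i) :: complex)" using geo unfolding z by simp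
  then have "r ^ n = (\<Sum>i<n. r ^ i)" by (simp only: of_real_eq_iff)
  then show ?thesis using multinacci_unique[OF n, of r] \<open>r \<ge> 1\<close> z by simp
qed

lemma prod_norm_less_1:
  fixes A :: "complex multiset"
  assumes "A \<noteq> {#}" "\<And>z. z \<in># A \<Longrightarrow> norm z < 1"
  shows "norm (\<Prod>z\<in>#A. - z) < 1"
  using assms
proof (induction A)
  case (add z A)
  have "norm z * norm (\<Prod>z\<in>#A. - z) < 1"
  proof (cases "A = {#}")
    case False
    then have "norm (\<Prod>z\<in>#A. - z) < 1" using add by auto
    moreover have "norm z < 1" using add.prems by auto
    ultimately show ?thesis using mult_strict_mono[of "norm z" 1 "norm (\<Prod>z\<in>#A. - z)" 1] by simp
  qed (use add.prems in simp)
  then show ?case by (simp add: norm_mult)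
qed simp

text \<open>Otherwise all roots of \<open>g\<close> lie inside the unit disc, so the integer g(0)
  has modulus below 1 and is 0. But the constant coefficient of the product is -1.\<close>

lemma multinacci_poly_factor_root:
  assumes n: "2 \<le> n" and f: "multinacci_poly n = g * h" and g: "\<bar>lead_coeff g\<bar> = 1" "degree g > 0"
  shows "ipoly g (of_real (multinacci n) :: complex) = 0"
proof (rule ccontr)
  assume nz: "ipoly g (of_real (multinacci n) :: complex) \<noteq> 0"
  let ?g = "map_poly of_int g :: complex poly"
  have "?g \<noteq> 0" using g(2) degree_of_int_poly[of g] by (metis degree_0 less_irrefl)
  then obtain A where A: "size A = degree ?g" "?g = smult (lead_coeff ?g) (\<Prod>x\<in>#A. [:-x, 1:])"
    using alg_closed_imp_factorization by blast
  have ev: "poly ?g z = lead_coeff ?g * (\<Prod>x\<in>#A. z - x)" for z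
    by (subst A(2)) (simp add: poly_prod_mset image_mset.compositionality o_def)
  have "norm x < 1" if "x \<in># A" for x
  proof (rule ccontr)
    assume "\<not> norm x < 1"
    have root: "ipoly g x = 0" unfolding ev using that by (auto simp: prod_mset_zero_iff)
    then have "ipoly (multinacci_poly n) x = 0" unfolding f by (simp add: map_poly_of_int_hom)
    then have "x = of_real (multinacci n)" using multinacci_poly_root[OF n] \<open>\<not> norm x < 1\<close> by simp
    with nz root show False by simp
  qed
  moreover have "A \<noteq> {#}" using A(1) g(2) by auto
  ultimately have "norm (\<Prod>x\<in>#A. - x) < 1" by (intro prod_norm_less_1)
  moreover have "norm (lead_coeff ?g) = \<bar>real_of_int (lead_coeff g)\<bar>" by (simp add: coeff_map_poly)
  then have "norm (lead_coeff ?g) = 1" using g(1) by linarith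
  moreover have "((-) 0) = (uminus :: complex \<Rightarrow> complex)" by (simp add: fun_eq_iff)
  ultimately have "norm (poly ?g 0) < 1" unfolding ev by (simp add: norm_mult)
  moreover have "poly ?g 0 = of_int (coeff g 0)" by (simp add: poly_0_coeff_0 coeff_map_poly)
  ultimately have "coeff g 0 = 0" by simp
  then have "coeff (multinacci_poly n) 0 = 0" unfolding f by (simp add: coeff_mult_0)
  then show False using n by (simp add: coeff_multinacci_poly)
qed

lemma pderiv_sum: "pderiv (sum f A) = (\<Sum>i\<in>A. pderiv (f i))"
  by (induction A rule: infinite_finite_induct) (auto simp: pderiv_add)

text \<open>At a double root \<gamma>, multiplying the derivative by \<gamma> gives n \<gamma>^n as
  the sum of the i \<gamma>^i over i < n. This is less than n times the sum of the \<gamma>^i, which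
  equals n \<gamma>^n.\<close>

lemma multinacci_poly_simple_root:
  assumes n: "2 \<le> n"
  shows "poly (pderiv (map_poly of_int (multinacci_poly n))) (of_real (multinacci n) :: complex) \<noteq> 0"
proof
  let ?g = "multinacci n"
  have pos: "?g > 0" using multinacci_props(2)[OF n] by simp
  assume "poly (pderiv (map_poly of_int (multinacci_poly n))) (of_real ?g :: complex) = 0"
  then have "of_nat n * of_real ?g ^ (n - 1) - (\<Sum>i<n. of_nat i * of_real ?g ^ (i - 1)) = (0 :: complex)"
    by (simp add: map_poly_multinacci_poly pderiv_diff pderiv_sum pderiv_monom poly_monom poly_sum)
  then have "of_real (of_nat n * ?g ^ (n - 1) - (\<Sum>i<n. of_nat i * ?g ^ (i - 1))) = (0 :: complex)" by simp
  then have "of_nat n * ?g ^ (n - 1) = (\<Sum>i<n. of_nat i * ?g ^ (i - 1))" by (simp only: of_real_eq_0_iff right_minus_eq)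
  then have "of_nat n * ?g ^ (n - 1) * ?g = (\<Sum>i<n. of_nat i * ?g ^ (i - 1) * ?g)" by (simp add: sum_distrib_right)
  moreover have "of_nat i * ?g ^ (i - 1) * ?g = of_nat i * ?g ^ i" for i by (cases i) auto
  ultimately have "of_nat n * ?g ^ n = (\<Sum>i<n. of_nat i * ?g ^ i)" by (simp only:)
  also have "\<dots> < (\<Sum>i<n. of_nat n * ?g ^ i)" using n pos by (intro sum_strict_mono) (auto simp: lessThan_empty_iff)
  also have "\<dots> = of_nat n * ?g ^ n" by (simp add: multinacci_power[OF n] sum_distrib_left)
  finally show False by simp
qed

text \<open>Two nonunit factors would both vanish at the multinacci number and make it a double
  root.\<close>

lemma irreducible_multinacci_poly:
  assumes n: "2 \<le> n"
  shows "irreducible (multinacci_poly n)"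
proof (rule irreducibleI)
  show "multinacci_poly n \<noteq> 0" using lead_coeff_multinacci_poly[of n] by auto
  show "\<not> multinacci_poly n dvd 1"
    using n dvd_imp_degree_le[of "multinacci_poly n" 1] by (auto simp: degree_multinacci_poly)
  fix g h assume f: "multinacci_poly n = g * h"
  show "g dvd 1 \<or> h dvd 1"
  proof (rule ccontr)
    assume nu: "\<not> (g dvd 1 \<or> h dvd 1)"
    let ?z = "of_real (multinacci n) :: complex"
    have "ipoly g ?z = 0"
      using multinacci_poly_factor_root[OF n f] monic_factor[of g h] f lead_coeff_multinacci_poly[of n] nu by simp
    moreover have f': "multinacci_poly n = h * g" using f by simp
    have "ipoly h ?z = 0"
      using multinacci_poly_factor_root[OF n f'] monic_factor[of h g] f' lead_coeff_multinacci_poly[of n] nu by simp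
    ultimately have "poly (pderiv (map_poly of_int (multinacci_poly n))) ?z = 0"
      unfolding f by (simp add: map_poly_of_int_hom pderiv_mult)
    with multinacci_poly_simple_root[OF n] show False by simp
  qed
qed

section \<open>Obstruction modulo 4 and irreducibility after iterated squaring of the
  variable\<close>

lemma coeff_mult_near_top:
  fixes p q :: "int poly"
  assumes "degree p \<le> m + 2" "degree q \<le> m + 2"
  shows "coeff (p * q) (2 * m + 4) = coeff p (m + 2) * coeff q (m + 2)"
    and "coeff (p * q) (2 * m + 3) = coeff p (m + 1) * coeff q (m + 2) + coeff p (m + 2) * coeff q (m + 1)"
    and "coeff (p * q) (2 * m + 2) =
           coeff p m * coeff q (m + 2) + coeff p (m + 1) * coeff q (m + 1) + coeff p (m + 2) * coeff q m"
proof -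
  have z: "coeff p i = 0" "coeff q i = 0" if "i > m + 2" for i
    using that assms by (auto intro: coeff_eq_0)
  have s: "coeff (p * q) k = (\<Sum>i\<in>S. coeff p i * coeff q (k - i))"
    if "S \<subseteq> {..k}" "\<And>i. i \<le> k \<Longrightarrow> i \<notin> S \<Longrightarrow> i > m + 2 \<or> k - i > m + 2" for S k
    unfolding coeff_mult using that(1)
  proof (intro sum.mono_neutral_right ballI)
    fix i assume "i \<in> {..k} - S"
    then show "coeff p i * coeff q (k - i) = 0" using that(2)[of i] z[of i] z[of "k - i"] by auto
  qed auto
  show "coeff (p * q) (2 * m + 4) = coeff p (m + 2) * coeff q (m + 2)"
    by (subst s[of "{m + 2}"]) auto
  show "coeff (p * q) (2 * m + 3) = coeff p (m + 1) * coeff q (m + 2) + coeff p (m + 2) * coeff q (m + 1)"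
    by (subst s[of "{m + 1, m + 2}"]) auto
  show "coeff (p * q) (2 * m + 2) =
      coeff p m * coeff q (m + 2) + coeff p (m + 1) * coeff q (m + 1) + coeff p (m + 2) * coeff q m"
    by (subst s[of "{m, m + 1, m + 2}"]) (auto simp: numeral_2_eq_2)
qed

lemma four_dvd_coeff:
  assumes "4 dvd (p :: int poly)"
  shows "4 dvd coeff p i"
  using assms by (auto elim!: dvdE simp: numeral_poly)

text \<open>In the first case the coefficients at 2n and 2n - 2 of the difference add up to plus or
  minus 2. In the second case the coefficient at 2n - 1 is -2.\<close>

lemma multinacci_poly_incongruence:
  assumes n: "2 \<le> n" and e: "e = 1 \<or> e = -1"
  defines "f \<equiv> multinacci_poly n"
  shows "\<not> 4 dvd f * neg_subst f - e * even_subst f"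
    and "\<not> 4 dvd f * f - e * even_subst f"
proof -
  obtain m where m: "n = m + 2" using n by (metis le_Suc_ex add.commute)
  have deg: "degree f \<le> m + 2" "degree (neg_subst f) \<le> m + 2"
    by (simp_all add: f_def degree_neg_subst degree_multinacci_poly m)
  note top = coeff_mult_near_top[OF deg] coeff_mult_near_top[OF deg(1,1)]
  have c: "coeff f (m + 2) = 1" "coeff f (m + 1) = -1" "coeff f m = -1"
    by (simp_all add: f_def coeff_multinacci_poly m)
  obtain c0 :: int where c0: "\<And>p. e * p = smult c0 p" "c0 = 1 \<or> c0 = -1"
    using e by (metis mult_minus1 mult_1 smult_1_left smult_minus_left)
  show "\<not> 4 dvd f * neg_subst f - e * even_subst f"
  proof
    assume *: "4 dvd f * neg_subst f - e * even_subst f"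
    have "4 dvd (-1) ^ m - c0"
      using four_dvd_coeff[OF *, of "2 * m + 4"]
      by (simp add: top c[simplified] coeff_neg_subst coeff_even_subst c0(1) del: One_nat_def)
    moreover have "4 dvd - 3 * (-1) ^ m + c0"
      using four_dvd_coeff[OF *, of "2 * m + 2"]
      by (simp add: top top[simplified] c[simplified] coeff_neg_subst coeff_even_subst c0(1) del: One_nat_def)
    ultimately have "4 dvd ((-1) ^ m - c0) + (- 3 * (-1) ^ m + c0)" by (rule dvd_add)
    then show False by (cases "even m") auto
  qed
  show "\<not> 4 dvd f * f - e * even_subst f"
  proof
    assume *: "4 dvd f * f - e * even_subst f"
    show False
      using four_dvd_coeff[OF *, of "2 * m + 3"] c c[simplified]
      by (simp add: top coeff_even_subst c0(1) del: One_nat_def)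
  qed
qed

lemma four_dvd_even_substD:
  assumes "4 dvd even_subst p"
  shows "4 dvd p"
proof -
  have "4 dvd coeff p i" for i
    using four_dvd_coeff[OF assms, of "2 * i"] by (simp add: coeff_even_subst)
  then have "[:4:] dvd p" by (simp add: const_poly_dvd_iff)
  then show ?thesis by (simp add: numeral_poly)
qed

lemma irreducible_even_subst_multinacci_poly:
  assumes n: "2 \<le> n"
  shows "irreducible ((even_subst ^^ k) (multinacci_poly n))"
proof (induction k)
  case 0
  then show ?case using irreducible_multinacci_poly[OF n] by simp
next
  case (Suc k)
  let ?f = "multinacci_poly n"
  define F where "F i = (even_subst ^^ i) ?f" for i
  have lc: "lead_coeff (F k) = 1"
    unfolding F_def by (induction k) (auto simp: lead_coeff_even_subst lead_coeff_multinacci_poly)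
  have deg: "degree (F k) > 0"
    unfolding F_def using n by (induction k) (auto simp: degree_even_subst degree_multinacci_poly)
  show ?case
  proof (rule ccontr)
    assume "\<not> irreducible ((even_subst ^^ Suc k) ?f)"
    then obtain m e where e: "e = 1 \<or> e = -1" and "m * neg_subst m = e * even_subst (F k)"
      using reducible_even_subst[of "F k"] Suc.IH lc deg by (auto simp: F_def)
    then have four: "4 dvd F k * neg_subst (F k) - e * even_subst (F k)" by (rule mult_neg_subst_cong4)
    show False
    proof (cases k)
      case 0
      then show ?thesis using four multinacci_poly_incongruence(1)[OF n e] by (simp add: F_def)
    next
      case (Suc j)
      \<comment> \<open>For \<open>k > 0\<close> the polynomial \<open>F k\<close> is even, so the
        congruence involves only its square. It is then a congruence in x^2, and one substitution
        after another can be removed.\<close>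
      have descend: "4 dvd F i * F i - e * even_subst (F i) \<Longrightarrow> 4 dvd F 0 * F 0 - e * even_subst (F 0)" for i
      proof (induction i)
        case (Suc i)
        have "even_subst e = e" using e by (auto simp: even_subst_simps)
        then have "F (Suc i) * F (Suc i) - e * even_subst (F (Suc i)) = even_subst (F i * F i - e * even_subst (F i))"
          by (simp add: F_def even_subst_simps)
        then show ?case using Suc four_dvd_even_substD by simp
      qed
      have "neg_subst (F k) = F k" using Suc by (simp add: F_def neg_subst_even_subst)
      then have "4 dvd F 0 * F 0 - e * even_subst (F 0)" using four descend[of k] by simp
      then show ?thesis using multinacci_poly_incongruence(2)[OF n e] by (simp add: F_def)
    qed
  qed
qed

lemma ipoly_even_subst_funpow: "ipoly ((even_subst ^^ k) p) z = ipoly p (z ^ (2 ^ k))"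
  by (induction k arbitrary: z) (auto simp: ipoly_even_subst power_mult[symmetric] simp flip: power_mult)

text \<open>As \<open>2 ^ k\<close> is even, -\<beta> is a root of the same irreducible polynomial
  as \<beta>, that is, a conjugate of it.\<close>

lemma negated_root_of_int_poly:
  fixes \<beta> :: real
  assumes n: "2 \<le> n" and "k \<ge> 1" "\<beta> ^ (2 ^ k) = multinacci n" "ipoly P \<beta> = 0"
  shows "ipoly P (- \<beta>) = 0"
proof -
  let ?F = "(even_subst ^^ k) (multinacci_poly n)"
  have root: "ipoly ?F x = 0" if "x ^ (2 ^ k) = multinacci n" for x :: real
    using that multinacci_power[OF n] by (simp add: ipoly_even_subst_funpow ipoly_multinacci_poly)
  have "ipoly ?F (of_real \<beta> :: complex) = 0" "ipoly P (of_real \<beta> :: complex) = 0"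
    using root[OF assms(3)] assms(4) by (simp_all add: ipoly_of_real)
  then have "?F dvd P" using irreducible_dvd_of_common_root irreducible_even_subst_multinacci_poly[OF n] by blast
  moreover have "(- \<beta>) ^ (2 ^ k) = multinacci n" using assms(2,3) by simp
  then have "ipoly ?F (- \<beta>) = 0" by (rule root)
  ultimately show ?thesis by (auto elim!: dvdE simp: map_poly_of_int_hom)
qed

section \<open>Non-sofic greedy and lazy shifts\<close>

lemma compact_bin_seqs: "compact bin_seqs"
proof -
  have "bin_seqs = PiE UNIV (\<lambda>_. {0, 1})" by (simp add: bin_seqs_def PiE_UNIV_domain)
  moreover have "compactin (product_topology (\<lambda>_. euclidean) UNIV) (PiE UNIV (\<lambda>_::nat. {0, 1::nat}))"
    unfolding compactin_PiE by (auto intro: finite_imp_compact)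
  ultimately show ?thesis by (simp add: euclidean_product_topology)
qed

text \<open>This is the Curtis-Hedlund-Lyndon argument. Counterexample pairs agreeing on longer and
  longer prefixes would have a common limit, near which the first digit of the image is
  constant.\<close>

lemma sliding_block_window:
  assumes "closed \<Xi>" "\<Xi> \<subseteq> bin_seqs" and \<pi>: "continuous_on \<Xi> \<pi>"
  shows "\<exists>L. \<forall>\<xi>\<in>\<Xi>. \<forall>\<xi>'\<in>\<Xi>. (\<forall>i<L. \<xi> i = \<xi>' i) \<longrightarrow> (\<pi> \<xi> 0 :: nat) = \<pi> \<xi>' 0"
proof (rule ccontr)
  assume "\<not> ?thesis"
  then obtain X Y where XY: "\<And>L. X L \<in> \<Xi>" "\<And>L. Y L \<in> \<Xi>" "\<And>L i. i < L \<Longrightarrow> X L i = Y L i"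
    "\<And>L. \<pi> (X L) 0 \<noteq> \<pi> (Y L) 0" by metis
  have "\<Xi> = bin_seqs \<inter> \<Xi>" using assms(2) by blast
  then have "compact \<Xi>" using compact_Int_closed[OF compact_bin_seqs assms(1)] by simp
  then have "seq_compact \<Xi>" by (rule compact_imp_seq_compact)
  then obtain \<xi> r where \<xi>: "\<xi> \<in> \<Xi>" "strict_mono r" "(X \<circ> r) \<longlonglongrightarrow> \<xi>"
    unfolding seq_compact_def using XY(1) by metis
  have "(Y \<circ> r) \<longlonglongrightarrow> \<xi>"
    unfolding seq_tendsto_iff
  proof
    fix i
    have "eventually (\<lambda>n. (X \<circ> r) n i = \<xi> i) sequentially" using \<xi>(3) unfolding seq_tendsto_iff by blast
    then show "eventually (\<lambda>n. (Y \<circ> r) n i = \<xi> i) sequentially"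
      using eventually_gt_at_top[of i]
    proof eventually_elim
      case (elim n)
      have "i < r n" using elim(2) strict_mono_imp_increasing[OF \<xi>(2), of n] by simp
      then show ?case using elim(1) XY(3)[of i "r n"] by simp
    qed
  qed
  have "eventually (\<lambda>n. \<pi> (Z (r n)) 0 = \<pi> \<xi> 0) sequentially"
    if "(Z \<circ> r) \<longlonglongrightarrow> \<xi>" "\<And>L. Z L \<in> \<Xi>" for Z
  proof -
    have "(\<lambda>n. \<pi> ((Z \<circ> r) n)) \<longlonglongrightarrow> \<pi> \<xi>"
      using that by (intro continuous_on_tendsto_compose[OF \<pi> _ \<xi>(1)]) (auto simp: o_def)
    then show ?thesis unfolding seq_tendsto_iff by simp
  qed
  from this[OF \<xi>(3) XY(1)] this[OF \<open>(Y \<circ> r) \<longlonglongrightarrow> \<xi>\<close> XY(2)]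
  have "eventually (\<lambda>n::nat. False) sequentially"
    by eventually_elim (use XY(4) in metis)
  then show False by simp
qed

text \<open>The sequence is cut before position \<open>i\<close> and continued from position
  \<open>j\<close>; if \<open>j < i\<close>, a block is repeated.\<close>

definition jump :: "nat \<Rightarrow> nat \<Rightarrow> (nat \<Rightarrow> 'a) \<Rightarrow> nat \<Rightarrow> 'a" where
  "jump i j \<xi> = (\<lambda>l. if l < i then \<xi> l else \<xi> (j + (l - i)))"

lemma left_shift_funpow_mem: "subshift \<Omega> \<Longrightarrow> \<omega> \<in> \<Omega> \<Longrightarrow> (left_shift ^^ i) \<omega> \<in> \<Omega>"
  by (induction i) (auto simp: subshift_def)

text \<open>The prefix of length \<open>i\<close> ends in the same \<open>M\<close> letters that
  precede position \<open>j\<close>, so whatever follows there may follow here. Closedness passes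
  from finite words to the whole sequence.\<close>

lemma subshift_finite_type_jump:
  assumes "subshift_finite_type \<Xi>"
  shows "\<exists>M\<ge>1. \<forall>\<xi>\<in>\<Xi>. \<forall>i\<ge>M. \<forall>j\<ge>M. (\<forall>l<M. \<xi> (i - M + l) = \<xi> (j - M + l)) \<longrightarrow> jump i j \<xi> \<in> \<Xi>"
proof -
  obtain M where sub: "subshift \<Xi>" and M: "M \<ge> 1" and
    ft: "\<And>u v. u \<in> prefix_words \<Xi> \<Longrightarrow> v \<in> prefix_words \<Xi> \<Longrightarrow> M \<le> length u \<Longrightarrow>
           drop (length u - M) u @ v \<in> prefix_words \<Xi> \<Longrightarrow> u @ v \<in> prefix_words \<Xi>"
    using assms unfolding subshift_finite_type_def by blast
  have "jump i j \<xi> \<in> \<Xi>"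
    if \<xi>: "\<xi> \<in> \<Xi>" and i: "M \<le> i" and j: "M \<le> j" and eq: "\<forall>l<M. \<xi> (i - M + l) = \<xi> (j - M + l)" for \<xi> i j
  proof -
    have "\<exists>\<eta>\<in>\<Xi>. \<forall>l<m. \<eta> l = jump i j \<xi> l" for m
    proof -
      obtain r where r: "m < r" by blast
      define u v where "u = map \<xi> [0..<i]" and "v = map (\<lambda>l. \<xi> (j + l)) [0..<r]"
      have shift: "(\<lambda>l. \<xi> (a + l)) \<in> \<Xi>" for a
        using left_shift_funpow_mem[OF sub \<xi>, of a] by (simp add: left_shift_funpow)
      have u: "u \<in> prefix_words \<Xi>" unfolding prefix_words_iff using \<xi> i M
        by (auto simp: u_def intro!: bexI[of _ \<xi>])
      have v: "v \<in> prefix_words \<Xi>" unfolding prefix_words_iff using shift[of j] r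
        by (auto simp: v_def intro!: bexI[of _ "\<lambda>l. \<xi> (j + l)"])
      have "\<xi> (j - M + l) = (drop (i - M) u @ v) ! l" if "l < length (drop (i - M) u @ v)" for l
      proof (cases "l < M")
        case True
        then have "(drop (i - M) u @ v) ! l = \<xi> (i - M + l)" using i by (simp add: u_def nth_append)
        then show ?thesis using eq True by simp
      next
        case False
        then have "l - M < r" using that i by (simp add: u_def v_def)
        then show ?thesis using that False i j by (simp add: u_def v_def nth_append)
      qed
      then have "drop (length u - M) u @ v \<in> prefix_words \<Xi>"
        unfolding prefix_words_iff using shift[of "j - M"] r
        by (auto simp: u_def v_def intro!: bexI[of _ "\<lambda>l. \<xi> (j - M + l)"])
      then have "u @ v \<in> prefix_words \<Xi>" using ft[OF u v] i by (simp add: u_def)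
      then obtain \<eta> where \<eta>: "\<eta> \<in> \<Xi>" "\<forall>l<length (u @ v). \<eta> l = (u @ v) ! l" unfolding prefix_words_iff by blast
      have "\<eta> l = jump i j \<xi> l" if "l < m" for l
      proof -
        have "\<eta> l = (u @ v) ! l" using \<eta>(2) that r by (simp add: v_def)
        then show ?thesis using that r by (auto simp: u_def v_def jump_def nth_append)
      qed
      then show ?thesis using \<eta>(1) by blast
    qed
    then show ?thesis using sub unfolding subshift_def closed_seq_iff by blast
  qed
  then show ?thesis using M by blast
qed

text \<open>Two positions with equal windows in a preimage of \<open>\<omega>\<close> can be exchanged in the SFT, hence in its factor.\<close>

lemma factor_of_SFT_jump:
  assumes \<Xi>: "subshift_finite_type \<Xi>" and "factor_of \<Omega> \<Xi>" and "\<omega> \<in> \<Omega>"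
  shows "\<exists>i j. i < j \<and> jump i j \<omega> \<in> \<Omega> \<and> jump j i \<omega> \<in> \<Omega>"
proof -
  obtain \<pi> where \<pi>: "continuous_on \<Xi> \<pi>" "\<pi> ` \<Xi> = \<Omega>" "\<And>\<xi>. \<xi> \<in> \<Xi> \<Longrightarrow> \<pi> (left_shift \<xi>) = left_shift (\<pi> \<xi>)"
    using assms(2) unfolding factor_of_def by blast
  have sub: "subshift \<Xi>" using \<Xi> by (simp add: subshift_finite_type_def)
  have shift: "\<pi> ((left_shift ^^ i) \<xi>) = (left_shift ^^ i) (\<pi> \<xi>)" if "\<xi> \<in> \<Xi>" for i \<xi>
    by (induction i) (use \<pi>(3) left_shift_funpow_mem[OF sub that] in auto)
  obtain L where L: "\<And>\<xi> \<xi>'. \<xi> \<in> \<Xi> \<Longrightarrow> \<xi>' \<in> \<Xi> \<Longrightarrow> (\<forall>i<L. \<xi> i = \<xi>' i) \<Longrightarrow> \<pi> \<xi> 0 = \<pi> \<xi>' 0"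
    using sliding_block_window[OF _ _ \<pi>(1)] sub unfolding subshift_def by metis
  have window: "\<pi> \<xi> a = \<pi> \<xi>' a" if "\<xi> \<in> \<Xi>" "\<xi>' \<in> \<Xi>" "\<forall>i<L. \<xi> (a + i) = \<xi>' (a + i)" for \<xi> \<xi>' a
  proof -
    have "\<pi> ((left_shift ^^ a) \<xi>) 0 = \<pi> ((left_shift ^^ a) \<xi>') 0"
      using that left_shift_funpow_mem[OF sub] by (intro L) (auto simp: left_shift_funpow)
    then show ?thesis unfolding shift[OF that(1)] shift[OF that(2)] by (simp add: left_shift_funpow)
  qed
  obtain M where M: "M \<ge> 1" "\<And>\<xi> i j. \<xi> \<in> \<Xi> \<Longrightarrow> i \<ge> M \<Longrightarrow> j \<ge> M \<Longrightarrow>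
      (\<forall>l<M. \<xi> (i - M + l) = \<xi> (j - M + l)) \<Longrightarrow> jump i j \<xi> \<in> \<Xi>"
    using subshift_finite_type_jump[OF \<Xi>] by blast
  obtain \<xi> where \<xi>: "\<xi> \<in> \<Xi>" "\<pi> \<xi> = \<omega>" using \<pi>(2) assms(3) by blast
  \<comment> \<open>\<open>M\<close> letters permit the exchange in the SFT; the further
    \<open>L\<close> letters keep it invisible to the factor map before the cut.\<close>
  define W where "W i = map (\<lambda>l. \<xi> (i + l)) [0..<M + L]" for i
  have bin: "\<xi> l = 0 \<or> \<xi> l = 1" for l using \<xi>(1) sub unfolding subshift_def bin_seqs_def by blast
  have "range W \<subseteq> {w. set w \<subseteq> {0, 1} \<and> length w = M + L}"
  proof (intro subsetI CollectI conjI)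
    fix w y assume "w \<in> range W" "y \<in> set w"
    then obtain l where "y = \<xi> l" by (auto simp: W_def)
    then show "y \<in> {0, 1}" using bin[of l] by simp
  qed (auto simp: W_def)
  then have "finite (range W)" using finite_lists_length_eq[of "{0, 1::nat}" "M + L"] finite_subset by blast
  then have "\<not> inj W" using finite_imageD by blast
  then obtain a b where ab: "a < b" "W a = W b" unfolding inj_def by (metis nat_neq_iff)
  have eq: "\<xi> (a + l) = \<xi> (b + l)" if "l < M + L" for l
    using arg_cong[OF ab(2), of "\<lambda>w. w ! l"] that by (simp add: W_def del: upt_Suc)
  have "jump (i + M) (j + M) \<omega> \<in> \<Omega>" if ij: "\<And>l. l < M + L \<Longrightarrow> \<xi> (i + l) = \<xi> (j + l)" for i j
  proof -
    let ?\<eta> = "jump (i + M) (j + M) \<xi>"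
    have \<eta>: "?\<eta> \<in> \<Xi>" using ij by (intro M(2)[OF \<xi>(1)]) auto
    \<comment> \<open>Agreement for \<open>L\<close> places beyond the cut leaves every image digit
      before the cut unchanged.\<close>
    have agree: "?\<eta> l = \<xi> l" if "l < i + M + L" for l
    proof (cases "l < i + M")
      case False
      then have "?\<eta> l = \<xi> (j + (l - i))" by (simp add: jump_def algebra_simps)
      also have "\<dots> = \<xi> (i + (l - i))" using ij[of "l - i"] that False by simp
      finally show ?thesis using False by simp
    qed (simp add: jump_def)
    have "(left_shift ^^ (i + M)) ?\<eta> = (left_shift ^^ (j + M)) \<xi>"
      by (simp add: left_shift_funpow jump_def fun_eq_iff)
    then have tail: "(left_shift ^^ (i + M)) (\<pi> ?\<eta>) = (left_shift ^^ (j + M)) \<omega>"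
      using shift[OF \<eta>, of "i + M"] shift[OF \<xi>(1), of "j + M"] \<xi>(2) by simp
    have "\<pi> ?\<eta> l = jump (i + M) (j + M) \<omega> l" for l
    proof (cases "l < i + M")
      case True
      have "\<pi> ?\<eta> l = \<pi> \<xi> l" using agree True by (intro window \<eta> \<xi>(1)) auto
      then show ?thesis using True \<xi>(2) by (simp add: jump_def)
    next
      case False
      then show ?thesis using fun_cong[OF tail, of "l - (i + M)"] by (simp add: left_shift_funpow jump_def)
    qed
    then have "jump (i + M) (j + M) \<omega> = \<pi> ?\<eta>" by (simp add: fun_eq_iff)
    then show ?thesis using \<eta> \<pi>(2) by auto
  qed
  from this[of a b] this[of b a] eq ab(1) show ?thesis
    by (intro exI[of _ "a + M"] exI[of _ "b + M"]) auto
qed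

section \<open>From exchangeable positions to a coincidence in the orbit of 1\<close>

text \<open>The difference of the two orbits is multiplied by \<beta> in each step, yet stays
  bounded by 1.\<close>

lemma expansion_unique:
  fixes x y :: "nat \<Rightarrow> real"
  assumes "1 < \<beta>" "\<And>i. x i \<in> {0..1}" "\<And>i. y i \<in> {0..1}"
    and "\<And>i. x (Suc i) = \<beta> * x i + c i" "\<And>i. y (Suc i) = \<beta> * y i + c i"
  shows "x 0 = y 0"
proof (rule ccontr)
  assume "x 0 \<noteq> y 0"
  have diff: "x i - y i = \<beta> ^ i * (x 0 - y 0)" for i
  proof (induction i)
    case (Suc i)
    have "x (Suc i) - y (Suc i) = \<beta> * (x i - y i)" by (simp add: assms(4,5) algebra_simps)
    then show ?case using Suc.IH by simp
  qed simp
  have *: "\<beta> ^ i * \<bar>x 0 - y 0\<bar> = \<bar>x i - y i\<bar>" for i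
    unfolding diff[of i] using assms(1) by (simp add: abs_mult)
  obtain i where "1 / \<bar>x 0 - y 0\<bar> < \<beta> ^ i" using real_arch_pow[OF assms(1)] by blast
  then have "1 < \<bar>x i - y i\<bar>" using \<open>x 0 \<noteq> y 0\<close> unfolding *[of i, symmetric] by (simp add: field_simps)
  then show False using assms(2,3)[of i] by (auto simp: abs_if split: if_splits)
qed

lemma beta_shift_orbit:
  assumes "1 < \<beta>" "0 \<le> \<alpha>" "\<alpha> \<le> 2 - \<beta>" "\<omega> \<in> beta_shift \<beta> \<alpha>"
  shows "\<exists>x. (\<forall>i. x i \<in> {0..1}) \<and> (\<forall>i. x (Suc i) = \<beta> * x i + (\<alpha> - \<omega> i))"
proof -
  consider x where "x \<in> {0..<1}" "\<omega> = tau_plus \<beta> \<alpha> x" | x where "x \<in> {0<..1}" "\<omega> = tau_minus \<beta> \<alpha> x"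
    using assms(4) by (auto simp: beta_shift_def)
  then show ?thesis
  proof cases
    case 1
    show ?thesis
      using T_plus_funpow_image[OF assms(1-3) 1(1)] T_plus_step[of \<beta> \<alpha> _ x] 1(2)
      by (intro exI[of _ "\<lambda>i. (T_plus \<beta> \<alpha> ^^ i) x"]) (auto simp: less_imp_le)
  next
    case 2
    show ?thesis
      using T_minus_funpow_image[OF assms(1-3) 2(1)] T_minus_step[of \<beta> \<alpha> _ x] 2(2)
      by (intro exI[of _ "\<lambda>i. (T_minus \<beta> \<alpha> ^^ i) x"]) (auto simp: less_imp_le)
  qed
qed

text \<open>A point with the jumped expansion starts at or below 1 and uses the digits of 1 up to
  time \<open>i\<close>, so it stays below the orbit of 1. At time \<open>i\<close> it equals the
  \<open>j\<close>-th point of that orbit, having the same digits from there on.\<close>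

lemma jump_orbit_le:
  assumes "1 < \<beta>" "0 \<le> \<alpha>" "\<alpha> \<le> 2 - \<beta>"
    and sp: "jump i j (tau_minus \<beta> \<alpha> 1) \<in> beta_shift \<beta> \<alpha>"
  shows "(T_minus \<beta> \<alpha> ^^ j) 1 \<le> (T_minus \<beta> \<alpha> ^^ i) 1"
proof -
  define \<omega> t where "\<omega> = tau_minus \<beta> \<alpha> 1" and "t i = (T_minus \<beta> \<alpha> ^^ i) 1" for i
  have t: "t i \<in> {0..1}" "t (Suc i) = \<beta> * t i + (\<alpha> - \<omega> i)" for i
    using T_minus_funpow_image[OF assms(1-3), of 1 i] T_minus_step[of \<beta> \<alpha> i 1]
    by (auto simp: t_def \<omega>_def)
  obtain x where x: "\<And>i. x i \<in> {0..1}" "\<And>l. x (Suc l) = \<beta> * x l + (\<alpha> - jump i j \<omega> l)"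
    using beta_shift_orbit[OF assms(1-3) sp] unfolding \<omega>_def by blast
  have "x (i + 0) = t (j + 0)"
  proof (rule expansion_unique[OF assms(1), of "\<lambda>l. x (i + l)" "\<lambda>l. t (j + l)" "\<lambda>l. \<alpha> - \<omega> (j + l)"])
    show "x (i + Suc l) = \<beta> * x (i + l) + (\<alpha> - real (\<omega> (j + l)))" for l
      using x(2)[of "i + l"] by (simp add: jump_def)
  qed (use x(1) t in auto)
  moreover have "x l \<le> t l" if "l \<le> i" for l
    using that
  proof (induction l)
    case 0
    then show ?case using x(1)[of 0] by (simp add: t_def)
  next
    case (Suc l)
    then show ?case using assms(1) by (simp add: x(2) t(2) jump_def)
  qed
  ultimately show ?thesis by (metis add_0_right order_refl t_def)
qed

text \<open>If \<open>d\<close> is the expansion of 1 in the greedy system, the value at \<beta> is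
  the \<open>i\<close>-th point of the orbit of 1.\<close>

primrec orbit_poly :: "(nat \<Rightarrow> nat) \<Rightarrow> nat \<Rightarrow> int poly" where
  "orbit_poly d 0 = 1"
| "orbit_poly d (Suc i) = pCons 0 (orbit_poly d i) - [:int (d i):]"

lemma ipoly_orbit_poly_Suc:
  "ipoly (orbit_poly d (Suc i)) x = x * ipoly (orbit_poly d i) x - of_nat (d i)"
  by (simp add: map_poly_of_int_hom map_poly_of_int_pCons)

text \<open>With \<open>b i = (-1)\<^sup>i U i (-\<beta>)\<close> and \<open>a i = U i \<beta>\<close> the difference satisfies
  \<open>b (i+1) - a (i+1) = \<beta> (b i - a i) + ((-1)\<^sup>i + 1) d i\<close>, so it never shrinks relative to \<open>\<beta>\<^sup>i\<close>.\<close>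

lemma orbit_poly_neg_growth:
  fixes \<beta> :: real
  assumes "1 < \<beta>" "d 0 = 1"
  shows "(-1) ^ Suc i * ipoly (orbit_poly d (Suc i)) (- \<beta>) - ipoly (orbit_poly d (Suc i)) \<beta> \<ge> 2 * \<beta> ^ i"
proof (induction i)
  case 0
  show ?case using assms by (simp add: ipoly_orbit_poly_Suc del: orbit_poly.simps(2))
next
  case (Suc i)
  define b a where "b = ipoly (orbit_poly d (Suc i)) (- \<beta>)" and "a = ipoly (orbit_poly d (Suc i)) \<beta>"
  have "2 * \<beta> ^ Suc i \<le> \<beta> * ((-1) ^ Suc i * b - a)"
    using mult_left_mono[OF Suc.IH, of \<beta>] assms(1) by (simp add: a_def b_def ac_simps)
  also have "\<dots> \<le> \<beta> * ((-1) ^ Suc i * b - a) + ((-1) ^ Suc i + 1) * real (d (Suc i))"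
    by (cases "even i") auto
  also have "\<dots> = (-1) ^ Suc (Suc i) * (- \<beta> * b - real (d (Suc i))) - (\<beta> * a - real (d (Suc i)))"
    by (simp add: algebra_simps)
  finally show ?case unfolding a_def b_def ipoly_orbit_poly_Suc[of d "Suc i"] .
qed

text \<open>A coincidence makes the orbit eventually periodic, so
  \<open>orbit_poly d l - orbit_poly d i\<close> vanishes at \<beta> for arbitrarily large
  \<open>l\<close>, hence also at -\<beta>. There the values would stay constant although they grow
  like \<beta>^l.\<close>

lemma greedy_orbit_injective:
  fixes \<beta> :: real
  assumes n: "2 \<le> n" and k: "k \<ge> 1" and \<beta>: "1 < \<beta>" "\<beta> ^ (2 ^ k) = multinacci n" "\<beta> \<le> 2"
    and "i < j"
  shows "(T_minus \<beta> 0 ^^ i) 1 \<noteq> (T_minus \<beta> 0 ^^ j) 1"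
proof
  define t where "t i = (T_minus \<beta> 0 ^^ i) 1" for i
  define d where "d = tau_minus \<beta> 0 1"
  assume "(T_minus \<beta> 0 ^^ i) 1 = (T_minus \<beta> 0 ^^ j) 1"
  then have per: "t (i + p * (j - i)) = t i" for p
  proof (induction p)
    case (Suc p)
    have "t (i + Suc p * (j - i)) = (T_minus \<beta> 0 ^^ (j - i)) (t (i + p * (j - i)))"
      using fun_cong[OF funpow_add[of "j - i" "i + p * (j - i)" "T_minus \<beta> 0"], of 1]
      by (simp add: t_def add.left_commute)
    also have "\<dots> = (T_minus \<beta> 0 ^^ (j - i)) (t i)" using Suc by simp
    also have "\<dots> = t j"
      using fun_cong[OF funpow_add[of "j - i" i "T_minus \<beta> 0"], of 1] \<open>i < j\<close> by (simp add: t_def)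
    finally show ?case using Suc.prems by (simp add: t_def)
  qed simp
  have t01: "t i \<in> {0..1}" for i
    using T_minus_funpow_image[of \<beta> 0 1 i] \<beta> by (auto simp: t_def)
  have U: "ipoly (orbit_poly d i) \<beta> = t i" for i
  proof (induction i)
    case (Suc i)
    then show ?case using T_minus_step[of \<beta> 0 i 1] by (simp add: ipoly_orbit_poly_Suc t_def d_def del: orbit_poly.simps)
  qed (simp add: t_def)
  define c where "c = ipoly (orbit_poly d i) (- \<beta>)"
  have "\<bar>c\<bar> \<ge> 2 * \<beta> ^ p" for p
  proof -
    define l where "l = i + Suc p * (j - i)"
    \<comment> \<open>Taking \<open>Suc p\<close> periods makes \<open>l\<close> positive with
      predecessor at least \<open>p\<close>, the form the growth estimate needs.\<close>
    have "Suc p * 1 \<le> Suc p * (j - i)" using \<open>i < j\<close> by (intro mult_le_mono) auto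
    then obtain l' where l': "l = Suc l'" "p \<le> l'" by (cases l) (auto simp: l_def)
    have "ipoly (orbit_poly d l - orbit_poly d i) \<beta> = 0"
      using per[of "Suc p"] by (simp add: map_poly_of_int_hom U l_def)
    then have "ipoly (orbit_poly d l - orbit_poly d i) (- \<beta>) = 0"
      by (rule negated_root_of_int_poly[OF n k \<beta>(2)])
    then have c: "c = ipoly (orbit_poly d (Suc l')) (- \<beta>)" by (simp add: map_poly_of_int_hom c_def l')
    have "d 0 = 1" using \<beta>(1) by (simp add: d_def tau_minus_def crit_def)
    from orbit_poly_neg_growth[of \<beta> d l', OF \<beta>(1) this]
    have "2 * \<beta> ^ l' \<le> (-1) ^ Suc l' * c" using t01[of "Suc l'"] by (simp add: U c del: orbit_poly.simps)
    also have "\<dots> \<le> \<bar>c\<bar>" by (cases "even l'") auto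
    finally have "2 * \<beta> ^ l' \<le> \<bar>c\<bar>" .
    moreover have "\<beta> ^ p \<le> \<beta> ^ l'" using \<beta>(1) l'(2) by (intro power_increasing) auto
    ultimately show ?thesis by linarith
  qed
  moreover obtain p where "\<bar>c\<bar> < \<beta> ^ p" using real_arch_pow[OF \<beta>(1)] by blast
  ultimately show False by (smt (verit) abs_ge_zero)
qed

text \<open>Jumps in both directions give both inequalities between two points of the orbit of 1,
  which are therefore equal.\<close>

lemma greedy_shift_not_factor_of_SFT:
  fixes \<beta> :: real
  assumes n: "2 \<le> n" and k: "k \<ge> 1" and \<beta>: "1 < \<beta>" "\<beta> ^ (2 ^ k) = multinacci n" "\<beta> \<le> 2"
    and \<Xi>: "subshift_finite_type \<Xi>"
  shows "\<not> factor_of (greedy_shift \<beta>) \<Xi>"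
proof
  assume "factor_of (greedy_shift \<beta>) \<Xi>"
  moreover have "tau_minus \<beta> 0 1 \<in> greedy_shift \<beta>" by (auto simp: greedy_shift_def beta_shift_def)
  ultimately obtain i j where "i < j" and
    "jump i j (tau_minus \<beta> 0 1) \<in> beta_shift \<beta> 0"
    "jump j i (tau_minus \<beta> 0 1) \<in> beta_shift \<beta> 0"
    using factor_of_SFT_jump[OF \<Xi>] unfolding greedy_shift_def by blast
  then have "(T_minus \<beta> 0 ^^ i) 1 = (T_minus \<beta> 0 ^^ j) 1"
    using jump_orbit_le[of \<beta> 0] \<beta> by (intro antisym) auto
  with greedy_orbit_injective[OF n k \<beta> \<open>i < j\<close>] show False by blast
qed

lemma factor_of_flip:
  assumes "factor_of \<Omega> \<Xi>"
  shows "factor_of (flip ` \<Omega>) \<Xi>"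
proof -
  obtain \<pi> where \<pi>: "continuous_on \<Xi> \<pi>" "\<pi> ` \<Xi> = \<Omega>" "\<forall>\<xi>\<in>\<Xi>. \<pi> (left_shift \<xi>) = left_shift (\<pi> \<xi>)"
    using assms unfolding factor_of_def by blast
  have "continuous_on UNIV (\<lambda>a::nat. 1 - a)" by (simp add: continuous_on_open_vimage open_discrete)
  then have "continuous_on UNIV flip"
    unfolding flip_def
    by (intro continuous_on_coordinatewise_then_product)
      (auto intro: continuous_on_compose2 continuous_on_product_coordinates)
  then have "continuous_on \<Xi> (\<lambda>\<xi>. flip (\<pi> \<xi>))" using \<pi>(1) continuous_on_compose2 by blast
  then show ?thesis
    unfolding factor_of_def using \<pi>(2,3)
    by (intro exI[of _ "\<lambda>\<xi>. flip (\<pi> \<xi>)"]) (auto simp: flip_def left_shift_def)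
qed

lemma subshift_finite_type_imp_sofic: "subshift_finite_type \<Omega> \<Longrightarrow> sofic \<Omega>"
  unfolding sofic_def factor_of_def
  by (intro conjI exI[of _ \<Omega>] exI[of _ "\<lambda>\<xi>. \<xi>"]) (auto simp: subshift_finite_type_def continuous_on_id)

theorem theorem1p1:
  fixes n k :: nat and \<beta> \<alpha> :: real
  assumes "n \<ge> 2" and "k \<ge> 1"
    and "\<beta> > 1" and "\<beta> ^ (2 ^ k) = multinacci n"
    and "\<alpha> = 1 - \<beta> / 2"
  shows "(\<not> transitive_map (T_plus \<beta> \<alpha>) \<and> \<not> transitive_map (T_minus \<beta> \<alpha>)) \<and>
         subshift_finite_type (beta_shift \<beta> \<alpha>) \<and>
         (transitive_map (greedy_map \<beta>) \<and> transitive_map (lazy_map \<beta>)) \<and>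
         (\<not> sofic (greedy_shift \<beta>) \<and> \<not> sofic (lazy_shift \<beta>) \<and>
          \<not> subshift_finite_type (greedy_shift \<beta>) \<and> \<not> subshift_finite_type (lazy_shift \<beta>))"
proof -
  have sq: "\<beta>\<^sup>2 < 2"
    using power2_le_of_power_two_power[OF assms(3,2)] multinacci_props(3)[OF assms(1)] assms(4) by linarith
  have "\<beta> \<le> \<beta>\<^sup>2" using assms(3) by (simp add: power2_eq_square)
  with sq have le2: "\<beta> \<le> 2" by linarith
  have crit: "crit \<beta> (1 - \<beta> / 2) = 1 / 2" using assms(3) by (intro crit_sym) simp
  \<comment> \<open>\<open>not_transitive_sym\<close> admits either branch at the critical point, so
    it applies to both maps.\<close>
  have "\<not> transitive_map (T_plus \<beta> (1 - \<beta> / 2))"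
    by (rule not_transitive_sym[OF assms(3) sq]) (auto simp: T_plus_def crit algebra_simps)
  moreover have "\<not> transitive_map (T_minus \<beta> (1 - \<beta> / 2))"
    by (rule not_transitive_sym[OF assms(3) sq]) (auto simp: T_minus_def crit algebra_simps)
  ultimately have nt: "\<not> transitive_map (T_plus \<beta> \<alpha>)" "\<not> transitive_map (T_minus \<beta> \<alpha>)"
    unfolding assms(5) .
  have sft: "subshift_finite_type (beta_shift \<beta> \<alpha>)"
    using sym_map_orbit_root[OF assms(1,3,4)] subshift_finite_type_sym[OF assms(3) le2]
    unfolding assms(5) by blast
  have greedy: "\<not> sofic (greedy_shift \<beta>)"
    using greedy_shift_not_factor_of_SFT[OF assms(1-4) le2] unfolding sofic_def by blast
  have lazy: "\<not> sofic (lazy_shift \<beta>)"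
  proof
    assume "sofic (lazy_shift \<beta>)"
    then obtain \<Xi> where "subshift_finite_type \<Xi>" "factor_of (lazy_shift \<beta>) \<Xi>" unfolding sofic_def by blast
    then show False
      using factor_of_flip greedy_shift_eq_flip_lazy_shift[of \<beta>] assms(3)
        greedy_shift_not_factor_of_SFT[OF assms(1-4) le2] by fastforce
  qed
  show ?thesis
    using nt sft transitive_greedy_map[OF assms(3) le2] transitive_lazy_map[OF assms(3) le2] greedy lazy
      subshift_finite_type_imp_sofic by blast
qed

end
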